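(* Let $\mathbf{S}_k=\{u_1,\dots,u_k\}\subset\mathbb{S}^{d-1}$ be fixed directions and let $\mathbf{P}_{\mathbf{S}_k}$ be the class of polytopes in $\mathbf{E}$ with fixed directions $\mathbf{S}_k$ of outer unit normal vectors. Suppose one observes a Poisson point process of intensity $\lambda$ on $P\in\mathbf{P}_{\mathbf{S}_k}$, and let $$\hat\vartheta_{\mathbf{P}_{\mathbf{S}_k}}=\frac{N+1}{N_\circ+1}\,|\hat P|.$$ Then the worst case mean squared error of $\hat\vartheta_{\mathbf{P}_{\mathbf{S}_k}}$ over the parameter class $\mathbf{P}_{\mathbf{S}_k}$ satisfies $$\sup_{P\in\mathbf{P}_{\mathbf{S}_k}}\mathbb{E}\big[(\hat\vartheta_{\mathbf{P}_{\mathbf{S}_k}}-|P|)^2\big]\lesssim\frac{k\,W(\lambda/k)}{\lambda^2},$$ whenever $\lambda|P|\ge 1$, where $W$ is the Lambert $W$ function, i.e. $W(z\mathrm{e}^{z})=z$. The rate can further be upper-bounded by $k\log(\lambda/k)/\lambda^2$.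
   Context: $|\cdot|$ denotes Lebesgue measure on $\mathbb{R}^d$. The directions $\mathbf{S}_k$ are such that there exists a polytope $P_{\mathbf{S}_k}$ whose outer unit normal vectors are exactly $u_1,\dots,u_k$; the observation window is the compact convex set $\mathbf{E}=P_{\mathbf{S}_k}$. The class $\mathbf{P}_{\mathbf{S}_k}$ consists of the polytopes contained in $\mathbf{E}$ whose facets have outer unit normal vectors in $\mathbf{S}_k$, i.e. sets of the form $\bigcap_{i=1}^k\{x:\langle x,u_i\rangle\le h_i\}\subseteq\mathbf{E}$; it is closed under arbitrary intersections. In the Poisson point process model of intensity $\lambda>0$ on $P$ one observes $N\sim\mathrm{Poiss}(\lambda|P|)$ points $X_1,\dots,X_N$, i.i.d. uniform on $P$ and independent of $N$. The wrapping hull is $$\hat P=\bigcap\{Q\in\mathbf{P}_{\mathbf{S}_k}:\{X_1,\dots,X_N\}\subseteq Q\},$$ and $N_\circ$ is the number of points $X_i$ lying in the interior of $\hat P$. $f\lesssim g$ means that $f$ is bounded by a constant multiple of $g$. The condition $\lambda|P|\ge1$ restricts the sets $P$ over which the supremum is taken.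
   Formalization: The final bound of the rate by k log(λ/k)/λ² is stated only for λ ≥ e·k, exactly the range where W(λ/k) ≤ log(λ/k); for λ ≤ k the logarithm is not positive and the bound fails. The constant depends on d and |E| only. *)

theory Defs
  imports "HOL-Probability.Probability"
begin

definition outer_facet_normals :: "(real ^ 'd) set \<Rightarrow> (real ^ 'd) set" where
  "outer_facet_normals E =
     {u. norm u = 1 \<and>
         (\<exists>b. E \<subseteq> {x. x \<bullet> u \<le> b} \<and> (E \<inter> {x. x \<bullet> u = b}) facet_of E)}"

text \<open>The observation window is a polytope whose outer unit facet normals are exactly the
  directions in \<open>S\<close>. The interior is required to be nonempty because facets of a
  lower-dimensional polytope do not have well-defined outer unit normals.\<close>

definition is_window :: "(real ^ 'd) set \<Rightarrow> (real ^ 'd) set \<Rightarrow> bool" where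
  "is_window S E \<longleftrightarrow>
     finite S \<and> polytope E \<and> interior E \<noteq> {} \<and> outer_facet_normals E = S"

definition polytope_class :: "(real ^ 'd) set \<Rightarrow> (real ^ 'd) set \<Rightarrow> (real ^ 'd) set set" where
  "polytope_class S E =
     {P. P \<subseteq> E \<and> (\<exists>h :: real ^ 'd \<Rightarrow> real. P = (\<Inter>u\<in>S. {x. x \<bullet> u \<le> h u}))}"

definition wrapping_hull :: "(real ^ 'd) set \<Rightarrow> (real ^ 'd) set \<Rightarrow> (real ^ 'd) set \<Rightarrow> (real ^ 'd) set" where
  "wrapping_hull S E A = \<Inter>{Q \<in> polytope_class S E. A \<subseteq> Q}"

text \<open>A sample is a pair \<open>(n, x)\<close>: the number of points and a sequence of which only the
  entries \<open>x 0, \<dots>, x (n - 1)\<close> are observed.\<close>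

definition sample_hull ::
    "(real ^ 'd) set \<Rightarrow> (real ^ 'd) set \<Rightarrow> nat \<Rightarrow> (nat \<Rightarrow> real ^ 'd) \<Rightarrow> (real ^ 'd) set" where
  "sample_hull S E n x = wrapping_hull S E (x ` {..<n})"

definition num_interior ::
    "(real ^ 'd) set \<Rightarrow> (real ^ 'd) set \<Rightarrow> nat \<Rightarrow> (nat \<Rightarrow> real ^ 'd) \<Rightarrow> nat" where
  "num_interior S E n x = card {i. i < n \<and> x i \<in> interior (sample_hull S E n x)}"

definition volume_estimator ::
    "(real ^ 'd) set \<Rightarrow> (real ^ 'd) set \<Rightarrow> nat \<Rightarrow> (nat \<Rightarrow> real ^ 'd) \<Rightarrow> real" where
  "volume_estimator S E n x =
     (real n + 1) / (real (num_interior S E n x) + 1) * measure lborel (sample_hull S E n x)"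

text \<open>The joint law of \<open>N\<close> and \<open>(X i)\<close>: \<open>N\<close> is Poisson with mean \<open>lam\<close> times the volume of
  \<open>P\<close>, the \<open>X i\<close> are i.i.d. uniform on \<open>P\<close>, and \<open>N\<close> is independent of the \<open>X i\<close>.
  This is meaningful for \<open>P\<close> of positive finite volume.\<close>

definition poisson_model ::
    "real \<Rightarrow> (real ^ 'd) set \<Rightarrow> (nat \<times> (nat \<Rightarrow> real ^ 'd)) measure" where
  "poisson_model lam P =
     measure_pmf (poisson_pmf (lam * measure lborel P)) \<Otimes>\<^sub>M
     PiM UNIV (\<lambda>_. uniform_measure lborel P)"

text \<open>The mean squared error is taken in the extended nonnegative reals, so that bounding it
  includes its finiteness.\<close>

definition mean_squared_error ::
    "real \<Rightarrow> (real ^ 'd) set \<Rightarrow> (real ^ 'd) set \<Rightarrow> (real ^ 'd) set \<Rightarrow> ennreal" where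
  "mean_squared_error lam S E P =
     (\<integral>\<^sup>+ (n, x). ennreal ((volume_estimator S E n x - measure lborel P)\<^sup>2) \<partial>poisson_model lam P)"

text \<open>The principal real branch of the Lambert function: for \<open>z \<ge> - exp (- 1)\<close>, the equation
  \<open>w * exp w = z\<close> has exactly one solution \<open>w \<ge> - 1\<close>.\<close>

definition lambert_W :: "real \<Rightarrow> real" where
  "lambert_W z = (THE w. - 1 \<le> w \<and> w * exp w = z)"

end

theory Submission
  imports Defs
begin

text \<open>
  Write \<open>m = \<lambda>|P|\<close>, let \<open>j\<close> be the number of sample points not in the interior of the hull and
  \<open>v = |hull| / |P|\<close>. Given the hull, the number of interior points is Poisson with mean \<open>m v\<close>, so
  \<open>j + m v\<close> is the conditional mean of the sample size. Splitting the variance of the sample size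
  accordingly gives \<open>E (j + m v - m)\<^sup>2 = E j\<close>. The error of the estimator, scaled by \<open>\<lambda>\<close>, is
  \<open>(j + m v - m) + j (m v / (n - j + 1) - 1)\<close>, and the conditional second moment of the last bracket
  is at most \<open>5 / (m v)\<close>. Almost surely \<open>j \<le> min k n\<close>, since a direction has only one maximiser; so
  both terms are of order \<open>min k m\<close> provided that \<open>v\<close> is rarely small.

  For the latter, take a point \<open>x\<^sub>0\<close> in the interior of \<open>P\<close> and \<open>d\<close> further points of \<open>P\<close> that span
  with it a parallelepiped of maximal volume: by Cramer's rule \<open>P\<close> lies in a bounded multiple of it. Hence \<open>d + 1\<close> small boxes
  near the vertices of the inscribed simplex each have a fixed fraction of the volume of \<open>P\<close>, any
  choice of one point per box has a hull containing a fixed fraction of \<open>P\<close>, and some box is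
  missed only with probability exponentially small in \<open>m\<close>. Finally \<open>W z \<ge> min 1 z / 2\<close>.
\<close>

section \<open>Poisson sums\<close>

text \<open>Conditioning on the hull is replaced by an explicit decomposition. The hull is
  determined by its extreme points, so an expectation splits over the index set of these points; for
  a given set of \<open>j\<close> indices the other \<open>l\<close> points must fall into the hull,
  each with probability \<open>v\<close>. Binomial coefficients times Poisson weights then factor,
  leaving for \<open>l\<close> a Poisson weight of mean \<open>m * v\<close>; this is where the
  Poisson sample size enters. The obstacle is that the conditional bound \<open>5 / (m * v)\<close>
  degenerates as \<open>v\<close> tends to 0. It is used only for \<open>v\<close> above a constant
  \<kappa>; below it the bracket has second moment at most 5, and the rarity of the event pays for
  the remaining factor \<open>m\<close> in the mean of \<open>j^2\<close>. The constant \<kappa>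
  must be uniform in \<open>P\<close>, \<open>k\<close> and \<lambda>: it comes from volume ratios
  in affine coordinates and depends on the dimension only. Both halves of \<open>min k m\<close>
  matter: for \<lambda> below \<open>k\<close> the claimed rate is of order 1/\<lambda>, and this
  follows from \<open>j \<le> n\<close>.\<close>

definition poisson_mean :: "real \<Rightarrow> (nat \<Rightarrow> ennreal) \<Rightarrow> ennreal" where
  "poisson_mean \<mu> f = (\<Sum>l. ennreal (\<mu> ^ l / fact l * exp (- \<mu>)) * f l)"

text \<open>Poisson expectations are handled as series in \<open>ennreal\<close>: these stay
  meaningful at mean 0, which occurs for hulls of mass 0, and they rearrange freely.\<close>

lemma nn_integral_poisson_pmf:
  assumes "0 < \<mu>"
  shows "(\<integral>\<^sup>+ l. f l \<partial>measure_pmf (poisson_pmf \<mu>)) = poisson_mean \<mu> f"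
  unfolding poisson_mean_def
  by (simp add: nn_integral_measure_pmf nn_integral_count_space_nat assms)

lemma poisson_mean_mono:
  "(\<And>l. f l \<le> g l) \<Longrightarrow> poisson_mean \<mu> f \<le> poisson_mean \<mu> g"
  unfolding poisson_mean_def by (intro suminf_le mult_left_mono) auto

lemma poisson_mean_add:
  "poisson_mean \<mu> (\<lambda>l. f l + g l) = poisson_mean \<mu> f + poisson_mean \<mu> g"
  unfolding poisson_mean_def distrib_left by (rule suminf_add[symmetric]) auto

lemma poisson_mean_cmult: "poisson_mean \<mu> (\<lambda>l. c * f l) = c * poisson_mean \<mu> f"
  unfolding poisson_mean_def by (simp add: mult.left_commute[of _ c])

lemma poisson_mean_const:
  assumes "0 \<le> \<mu>"
  shows "poisson_mean \<mu> (\<lambda>l. c) = c"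
proof -
  have "(\<lambda>l. \<mu> ^ l /\<^sub>R fact l) sums exp \<mu>"
    by (rule exp_converges)
  then have "(\<lambda>l. \<mu> ^ l / fact l * exp (- \<mu>)) sums (exp \<mu> * exp (- \<mu>))"
    by (intro sums_mult2) (simp add: divide_inverse mult.commute)
  then have "(\<Sum>l. ennreal (\<mu> ^ l / fact l * exp (- \<mu>))) = 1"
    using assms by (subst suminf_ennreal_eq) (auto simp: exp_minus_inverse)
  then show ?thesis
    unfolding poisson_mean_def by simp
qed

text \<open>Size biasing: \<open>l\<close> times a Poisson weight is \<mu> times the preceding
  weight. Read from right to left it removes denominators, which is how the moments of
  \<open>1 / (l + 1)\<close> are found below.\<close>

lemma poisson_mean_Suc:
  assumes "0 \<le> \<mu>"
  shows "poisson_mean \<mu> (\<lambda>l. of_nat l * f l) = ennreal \<mu> * poisson_mean \<mu> (\<lambda>l. f (Suc l))"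
proof -
  define w where "w l = ennreal (\<mu> ^ l / fact l * exp (- \<mu>)) * (of_nat l * f l)" for l
  have "w (Suc l) = ennreal \<mu> * (ennreal (\<mu> ^ l / fact l * exp (- \<mu>)) * f (Suc l))" for l
  proof -
    have "ennreal (\<mu> ^ Suc l / fact (Suc l) * exp (- \<mu>)) * ennreal (real (Suc l))
        = ennreal (\<mu> ^ Suc l / fact (Suc l) * exp (- \<mu>) * real (Suc l))"
      using assms by (subst ennreal_mult) auto
    also have "\<mu> ^ Suc l / fact (Suc l) * exp (- \<mu>) * real (Suc l) = \<mu> * (\<mu> ^ l / fact l * exp (- \<mu>))"
      by (simp add: divide_simps del: of_nat_Suc)
    also have "ennreal \<dots> = ennreal \<mu> * ennreal (\<mu> ^ l / fact l * exp (- \<mu>))"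
      using assms by (subst ennreal_mult) auto
    finally show ?thesis
      by (simp add: w_def ennreal_of_nat_eq_real_of_nat mult.assoc[symmetric] del: power_Suc fact_Suc of_nat_Suc)
  qed
  moreover have "(\<Sum>l. w l) = (\<Sum>l. w (Suc l)) + w 0"
    using suminf_offset[of w 1] by (simp add: add.commute)
  moreover have "w 0 = 0"
    by (simp add: w_def)
  ultimately show ?thesis
    unfolding poisson_mean_def w_def[symmetric] by simp
qed

text \<open>Reweighting by \<open>r ^ l\<close> gives a Poisson law of mean \<open>\<mu> * r\<close>
  up to normalisation. With \<open>r\<close> the probability that a point misses a region, this
  evaluates expectations on the event that all points miss it.\<close>

lemma poisson_mean_thinning:
  assumes "0 \<le> \<mu>" "0 \<le> r"
  shows "poisson_mean \<mu> (\<lambda>l. ennreal (r ^ l) * f l)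
    = ennreal (exp (- (\<mu> * (1 - r)))) * poisson_mean (\<mu> * r) f"
proof -
  have "ennreal (\<mu> ^ l / fact l * exp (- \<mu>)) * (ennreal (r ^ l) * f l)
      = ennreal (exp (- (\<mu> * (1 - r)))) * (ennreal ((\<mu> * r) ^ l / fact l * exp (- (\<mu> * r))) * f l)" for l
  proof -
    have "\<mu> ^ l / fact l * exp (- \<mu>) * r ^ l
        = exp (- (\<mu> * (1 - r))) * ((\<mu> * r) ^ l / fact l * exp (- (\<mu> * r)))"
      by (simp add: power_mult_distrib algebra_simps exp_diff exp_minus divide_inverse)
    then have "ennreal (\<mu> ^ l / fact l * exp (- \<mu>)) * ennreal (r ^ l)
        = ennreal (exp (- (\<mu> * (1 - r)))) * ennreal ((\<mu> * r) ^ l / fact l * exp (- (\<mu> * r)))"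
      using assms by (subst (1 2) ennreal_mult[symmetric]) auto
    then show ?thesis
      by (simp add: mult.assoc[symmetric])
  qed
  then show ?thesis
    unfolding poisson_mean_def by simp
qed

lemma poisson_mean_of_nat:
  assumes "0 \<le> \<mu>"
  shows "poisson_mean \<mu> of_nat = ennreal \<mu>"
  using poisson_mean_Suc[OF assms, of "\<lambda>_. 1"] by (simp add: poisson_mean_const assms)

lemma poisson_mean_of_nat_power2:
  assumes "0 \<le> \<mu>"
  shows "poisson_mean \<mu> (\<lambda>l. of_nat (l\<^sup>2)) = ennreal (\<mu>\<^sup>2 + \<mu>)"
proof -
  have "poisson_mean \<mu> (\<lambda>l. of_nat (l\<^sup>2)) = ennreal \<mu> * poisson_mean \<mu> (\<lambda>l. of_nat l + 1)"
    using poisson_mean_Suc[OF assms, of of_nat] by (simp add: power2_eq_square add.commute)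
  also have "\<dots> = ennreal \<mu> * (ennreal \<mu> + 1)"
    by (simp add: poisson_mean_add poisson_mean_of_nat poisson_mean_const assms)
  also have "\<dots> = ennreal (\<mu>\<^sup>2 + \<mu>)"
    using assms by (simp add: ennreal_mult[symmetric] ennreal_plus[symmetric]
        ennreal_1[symmetric] distrib_left power2_eq_square del: ennreal_1 ennreal_plus)
  finally show ?thesis .
qed

lemma poisson_mean_shifted_square:
  assumes "0 \<le> \<mu>"
  shows "poisson_mean \<mu> (\<lambda>l. ennreal ((a + real l)\<^sup>2)) = ennreal ((a + \<mu>)\<^sup>2 + \<mu>)"
proof -
  \<comment> \<open>The cross term \<open>2 * a * l\<close> may be negative, which
    \<open>ennreal\<close> cannot express. Adding \<open>2 * |a| * l\<close> on both sides makes all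
    terms nonnegative; its mean is finite and is cancelled at the end.\<close>
  have pw: "ennreal ((a + real l)\<^sup>2) + ennreal (2 * \<bar>a\<bar>) * of_nat l
      = ennreal (a\<^sup>2) + (ennreal (2 * a + 2 * \<bar>a\<bar>) * of_nat l + of_nat (l\<^sup>2))" for l
  proof -
    have "(a + real l)\<^sup>2 + 2 * \<bar>a\<bar> * real l = a\<^sup>2 + ((2 * a + 2 * \<bar>a\<bar>) * real l + real (l\<^sup>2))"
      by (simp add: power2_eq_square algebra_simps)
    then have "ennreal ((a + real l)\<^sup>2 + 2 * \<bar>a\<bar> * real l)
        = ennreal (a\<^sup>2 + ((2 * a + 2 * \<bar>a\<bar>) * real l + real (l\<^sup>2)))"
      by (rule arg_cong)
    then show ?thesis
      by (simp add: ennreal_plus ennreal_mult ennreal_of_nat_eq_real_of_nat)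
  qed
  have "poisson_mean \<mu> (\<lambda>l. ennreal ((a + real l)\<^sup>2) + ennreal (2 * \<bar>a\<bar>) * of_nat l)
      = poisson_mean \<mu> (\<lambda>l. ennreal (a\<^sup>2) + (ennreal (2 * a + 2 * \<bar>a\<bar>) * of_nat l + of_nat (l\<^sup>2)))"
    by (simp only: pw)
  then have "poisson_mean \<mu> (\<lambda>l. ennreal ((a + real l)\<^sup>2)) + ennreal (2 * \<bar>a\<bar>) * ennreal \<mu>
      = ennreal (a\<^sup>2) + (ennreal (2 * a + 2 * \<bar>a\<bar>) * ennreal \<mu> + ennreal (\<mu>\<^sup>2 + \<mu>))"
    by (simp only: poisson_mean_add poisson_mean_cmult poisson_mean_const[OF assms]
        poisson_mean_of_nat[OF assms] poisson_mean_of_nat_power2[OF assms])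
  also have "\<dots> = ennreal (a\<^sup>2 + ((2 * a + 2 * \<bar>a\<bar>) * \<mu> + (\<mu>\<^sup>2 + \<mu>)))"
    using assms by (simp add: ennreal_mult ennreal_plus)
  also have "a\<^sup>2 + ((2 * a + 2 * \<bar>a\<bar>) * \<mu> + (\<mu>\<^sup>2 + \<mu>)) = ((a + \<mu>)\<^sup>2 + \<mu>) + 2 * \<bar>a\<bar> * \<mu>"
    by (simp add: power2_eq_square algebra_simps)
  also have "ennreal \<dots> = ennreal ((a + \<mu>)\<^sup>2 + \<mu>) + ennreal (2 * \<bar>a\<bar>) * ennreal \<mu>"
    using assms by (simp add: ennreal_mult ennreal_plus)
  finally show ?thesis
    by (simp add: ennreal_add_left_cancel add.commute ennreal_mult_eq_top_iff)
qed

text \<open>By size biasing, the mean of \<open>\<mu> / (l + 1)\<close> is the probability of a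
  positive count. The form as a sum avoids truncated subtraction.\<close>

lemma poisson_mean_inverse_Suc:
  assumes "0 < \<mu>"
  shows "poisson_mean \<mu> (\<lambda>l. ennreal (\<mu> / (real l + 1))) + ennreal (exp (- \<mu>)) = 1"
proof -
  have "poisson_mean \<mu> (\<lambda>l. ennreal (\<mu> / (real l + 1)))
      = poisson_mean \<mu> (\<lambda>l. ennreal \<mu> * ennreal (1 / real (Suc l)))"
    using assms by (simp add: ennreal_mult[symmetric] add.commute)
  also have "\<dots> = poisson_mean \<mu> (\<lambda>l. of_nat l * ennreal (1 / real l))"
    using assms by (subst poisson_mean_Suc) (simp_all add: poisson_mean_cmult)
  also have "\<dots> = poisson_mean \<mu> (\<lambda>l. if l = 0 then 0 else 1)"
    by (intro arg_cong[of _ _ "poisson_mean \<mu>"] ext)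
      (simp add: ennreal_of_nat_eq_real_of_nat ennreal_mult[symmetric])
  finally have "poisson_mean \<mu> (\<lambda>l. ennreal (\<mu> / (real l + 1)))
      = poisson_mean \<mu> (\<lambda>l. if l = 0 then 0 else 1)" .
  moreover have "poisson_mean \<mu> (\<lambda>l. if l = 0 then 1 else 0) = ennreal (exp (- \<mu>))"
    unfolding poisson_mean_def by (subst suminf_finite[of "{0}"]) auto
  moreover have "poisson_mean \<mu> (\<lambda>l. if l = 0 then 0 else 1) + poisson_mean \<mu> (\<lambda>l. if l = 0 then 1 else 0)
      = poisson_mean \<mu> (\<lambda>l. 1)"
    unfolding poisson_mean_add[symmetric] by (intro arg_cong[of _ _ "poisson_mean \<mu>"] ext) simp
  ultimately show ?thesis
    using assms by (simp add: poisson_mean_const)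
qed

lemma poisson_mean_inverse_Suc_le:
  assumes "0 < \<mu>"
  shows "poisson_mean \<mu> (\<lambda>l. ennreal (\<mu> / (real l + 1))) \<le> 1"
  using poisson_mean_inverse_Suc[OF assms] by (metis le_iff_add)

text \<open>After one size biasing the integrand is \<open>\<mu> / l\<close> for positive
  \<open>l\<close>, and \<open>1 / l \<le> 1 / (l + 1) + 3 / ((l + 1) * (l + 2))\<close>, where the
  3 comes from \<open>l + 2 \<le> 3 * l\<close>. The first part has mean at most 1. The second is
  the value at \<open>Suc l\<close> of \<open>3 / (l * (l + 1))\<close>, so that size biasing
  applies again and leaves \<open>3 / (l + 1)\<close>.\<close>

lemma poisson_mean_inverse_Suc_square_le:
  assumes "0 < \<mu>"
  shows "poisson_mean \<mu> (\<lambda>l. ennreal ((\<mu> / (real l + 1))\<^sup>2)) \<le> 1 + ennreal (3 / \<mu>)"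
proof -
  have "poisson_mean \<mu> (\<lambda>l. ennreal ((\<mu> / (real l + 1))\<^sup>2))
      = poisson_mean \<mu> (\<lambda>l. ennreal \<mu> * ennreal (\<mu> / (real (Suc l))\<^sup>2))"
    using assms by (simp add: ennreal_mult[symmetric] power2_eq_square add.commute)
  also have "\<dots> = poisson_mean \<mu> (\<lambda>l. of_nat l * ennreal (\<mu> / (real l)\<^sup>2))"
    using assms by (subst poisson_mean_Suc) (simp_all add: poisson_mean_cmult)
  also have "\<dots> \<le> poisson_mean \<mu> (\<lambda>l. ennreal (\<mu> / (real l + 1))
      + ennreal \<mu> * ennreal (3 / (real (Suc l) * (real (Suc l) + 1))))"
  proof (intro poisson_mean_mono)
    fix l
    have "real l * (\<mu> / (real l)\<^sup>2) \<le> \<mu> / (real l + 1) + \<mu> * (3 / (real (Suc l) * (real (Suc l) + 1)))"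
    proof (cases "l = 0")
      case True
      then show ?thesis using assms by simp
    next
      case False
      then have l: "1 \<le> real l" by simp
      have "1 / real l = 1 / (real l + 1) + 1 / ((real l + 1) * real l)"
      proof -
        have "1 / real l = (real l + 1) / ((real l + 1) * real l)"
          using l by simp
        also have "\<dots> = real l / ((real l + 1) * real l) + 1 / ((real l + 1) * real l)"
          by (rule add_divide_distrib)
        also have "real l / ((real l + 1) * real l) = 1 / (real l + 1)"
          using l by simp
        finally show ?thesis .
      qed
      also have "1 / ((real l + 1) * real l) \<le> 3 / ((real l + 1) * (real l + 2))"
      proof -
        have "1 / ((real l + 1) * real l) = 3 / ((real l + 1) * (3 * real l))"
          using l by simp
        also have "\<dots> \<le> 3 / ((real l + 1) * (real l + 2))"
          using l by (intro divide_left_mono mult_left_mono mult_pos_pos) auto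
        finally show ?thesis .
      qed
      finally have "\<mu> * (1 / real l) \<le> \<mu> * (1 / (real l + 1) + 3 / ((real l + 1) * (real l + 2)))"
        using assms by (intro mult_left_mono) auto
      then show ?thesis
        using assms l by (simp add: algebra_simps power2_eq_square)
    qed
    then have "ennreal (real l * (\<mu> / (real l)\<^sup>2))
        \<le> ennreal (\<mu> / (real l + 1) + \<mu> * (3 / (real (Suc l) * (real (Suc l) + 1))))"
      by (rule ennreal_leI)
    then show "of_nat l * ennreal (\<mu> / (real l)\<^sup>2)
        \<le> ennreal (\<mu> / (real l + 1)) + ennreal \<mu> * ennreal (3 / (real (Suc l) * (real (Suc l) + 1)))"
      using assms
      by (simp add: ennreal_of_nat_eq_real_of_nat ennreal_mult[symmetric] ennreal_plus[symmetric]
          del: ennreal_plus of_nat_Suc)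
  qed
  also have "\<dots> = poisson_mean \<mu> (\<lambda>l. ennreal (\<mu> / (real l + 1)))
      + poisson_mean \<mu> (\<lambda>l. of_nat l * ennreal (3 / (real l * (real l + 1))))"
    using assms by (simp only: poisson_mean_add poisson_mean_cmult poisson_mean_Suc less_imp_le)
  also have "\<dots> \<le> 1 + ennreal (3 / \<mu>) * poisson_mean \<mu> (\<lambda>l. ennreal (\<mu> / (real l + 1)))"
    unfolding poisson_mean_cmult[symmetric]
  proof (intro add_mono poisson_mean_mono poisson_mean_inverse_Suc_le assms)
    fix l
    show "of_nat l * ennreal (3 / (real l * (real l + 1))) \<le> ennreal (3 / \<mu>) * ennreal (\<mu> / (real l + 1))"
      using assms by (cases "l = 0") (auto simp: ennreal_of_nat_eq_real_of_nat ennreal_mult[symmetric])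
  qed
  also have "\<dots> \<le> 1 + ennreal (3 / \<mu>) * 1"
    by (intro add_mono mult_left_mono poisson_mean_inverse_Suc_le assms) auto
  finally show ?thesis by simp
qed

lemma poisson_mean_ratio_le:
  assumes "0 < \<mu>"
  shows "poisson_mean \<mu> (\<lambda>l. ennreal ((\<mu> / (real l + 1) - 1)\<^sup>2)) \<le> ennreal (5 / \<mu>)"
    (is "?E \<le> _")
proof -
  let ?A = "poisson_mean \<mu> (\<lambda>l. ennreal (\<mu> / (real l + 1)))"
  have pw: "ennreal ((\<mu> / (real l + 1) - 1)\<^sup>2) + 2 * ennreal (\<mu> / (real l + 1))
      = ennreal ((\<mu> / (real l + 1))\<^sup>2) + 1" for l
  proof -
    have "ennreal ((\<mu> / (real l + 1) - 1)\<^sup>2 + 2 * (\<mu> / (real l + 1))) = ennreal ((\<mu> / (real l + 1))\<^sup>2 + 1)"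
      by (rule arg_cong[of _ _ ennreal]) (simp add: power2_eq_square algebra_simps)
    then show ?thesis
      using assms by (simp add: ennreal_plus ennreal_mult ennreal_mult[of 2, simplified] del: times_divide_eq_right)
  qed
  have "poisson_mean \<mu> (\<lambda>l. ennreal ((\<mu> / (real l + 1) - 1)\<^sup>2) + 2 * ennreal (\<mu> / (real l + 1)))
      = poisson_mean \<mu> (\<lambda>l. ennreal ((\<mu> / (real l + 1))\<^sup>2) + 1)"
    by (simp only: pw)
  then have "?E + 2 * ?A = poisson_mean \<mu> (\<lambda>l. ennreal ((\<mu> / (real l + 1))\<^sup>2)) + 1"
    by (simp only: poisson_mean_add poisson_mean_cmult poisson_mean_const[OF less_imp_le[OF assms]])
  \<comment> \<open>Twice the first moment plus \<open>2 * exp (- \<mu>)\<close> is exactly 2, which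
    removes the linear term of the square and leaves
    \<open>3 / \<mu> + 2 * exp (- \<mu>)\<close>.\<close>
  then have "?E + 2 * ?A + 2 * ennreal (exp (- \<mu>)) \<le> (1 + ennreal (3 / \<mu>)) + 1 + 2 * ennreal (exp (- \<mu>))"
    using poisson_mean_inverse_Suc_square_le[OF assms] by (simp only: add_mono order_refl)
  moreover have "?E + 2 * ?A + 2 * ennreal (exp (- \<mu>)) = ?E + 2 * (?A + ennreal (exp (- \<mu>)))"
    by (simp add: distrib_left add.assoc)
  ultimately have "?E + ennreal 2 \<le> (1 + ennreal (3 / \<mu>)) + 1 + 2 * ennreal (exp (- \<mu>))"
    unfolding poisson_mean_inverse_Suc[OF assms] by simp
  also have "\<dots> = ennreal (3 / \<mu> + 2 * exp (- \<mu>)) + ennreal 2"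
  proof -
    have "(1 + ennreal (3 / \<mu>)) + 1 + 2 * ennreal (exp (- \<mu>)) = ennreal (1 + 3 / \<mu> + 1 + 2 * exp (- \<mu>))"
      using assms by (simp add: ennreal_plus ennreal_mult)
    also have "1 + 3 / \<mu> + 1 + 2 * exp (- \<mu>) = (3 / \<mu> + 2 * exp (- \<mu>)) + 2" by simp
    also have "ennreal \<dots> = ennreal (3 / \<mu> + 2 * exp (- \<mu>)) + ennreal 2"
      using assms by (intro ennreal_plus) auto
    finally show ?thesis .
  qed
  finally have "?E \<le> ennreal (3 / \<mu> + 2 * exp (- \<mu>))"
    by (simp only: ennreal_add_left_cancel_le add.commute[of _ "ennreal 2"]) simp
  also have "exp (- \<mu>) \<le> 1 / \<mu>"
  proof -
    have "\<mu> \<le> exp \<mu>"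
      using exp_ge_add_one_self[of \<mu>] by linarith
    then show ?thesis
      using assms by (simp add: exp_minus field_simps)
  qed
  then have "ennreal (3 / \<mu> + 2 * exp (- \<mu>)) \<le> ennreal (5 / \<mu>)"
    by (intro ennreal_leI) auto
  finally show ?thesis .
qed

text \<open>Covers small means, where \<open>5 / \<mu>\<close> is useless: there
  \<open>\<mu> / (l + 1)\<close> lies in [0, 1]. Together the two bounds give 5 for every
  mean.\<close>

lemma poisson_mean_ratio_le_one:
  assumes "0 \<le> \<mu>" "\<mu> \<le> 1"
  shows "poisson_mean \<mu> (\<lambda>l. ennreal ((\<mu> / (real l + 1) - 1)\<^sup>2)) \<le> 1"
proof -
  have "(\<mu> / (real l + 1) - 1)\<^sup>2 \<le> 1" for l
  proof -
    have "\<bar>\<mu> / (real l + 1) - 1\<bar> \<le> 1"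
      using assms by (auto simp: abs_le_iff field_simps)
    then show ?thesis
      by (simp only: abs_square_le_1)
  qed
  then have "poisson_mean \<mu> (\<lambda>l. ennreal ((\<mu> / (real l + 1) - 1)\<^sup>2)) \<le> poisson_mean \<mu> (\<lambda>l. 1)"
    by (intro poisson_mean_mono) auto
  then show ?thesis
    by (simp add: poisson_mean_const assms)
qed

section \<open>Rearrangement of double series\<close>

lemma suminf_ennreal_swap:
  fixes g :: "nat \<Rightarrow> nat \<Rightarrow> ennreal"
  shows "(\<Sum>n. \<Sum>j. g n j) = (\<Sum>j. \<Sum>n. g n j)"
  using trans[OF nn_integral_fst_count_space[of "\<lambda>(n, j). g n j"]
      nn_integral_snd_count_space[of "\<lambda>(n, j). g n j", symmetric]]
  by (simp add: nn_integral_count_space_nat)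

text \<open>Used with \<open>j\<close> the number of extreme points and \<open>l = n - j\<close> the
  number of the others, so that a sum over sample sizes becomes a sum over both counts
  separately.\<close>

lemma suminf_ennreal_triangle:
  fixes a :: "nat \<Rightarrow> nat \<Rightarrow> ennreal"
  shows "(\<Sum>n. \<Sum>j\<le>n. a j (n - j)) = (\<Sum>j. \<Sum>l. a j l)"
proof -
  have "(\<Sum>n. \<Sum>j\<le>n. a j (n - j)) = (\<Sum>n. \<Sum>j. if j \<le> n then a j (n - j) else 0)"
  proof (rule suminf_cong)
    fix n
    show "(\<Sum>j\<le>n. a j (n - j)) = (\<Sum>j. if j \<le> n then a j (n - j) else 0)"
      by (subst suminf_finite[of "{..n}"]) auto
  qed
  also have "\<dots> = (\<Sum>j. \<Sum>n. if j \<le> n then a j (n - j) else 0)"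
    by (rule suminf_ennreal_swap)
  also have "\<dots> = (\<Sum>j. \<Sum>l. a j l)"
  proof (rule suminf_cong)
    fix j
    show "(\<Sum>n. if j \<le> n then a j (n - j) else 0) = (\<Sum>l. a j l)"
      by (subst suminf_offset[of _ j]) auto
  qed
  finally show ?thesis .
qed

section \<open>Hulls with fixed directions\<close>

text \<open>For a window \<open>E\<close> this is the interior of the wrapping hull of a finite
  nonempty sample \<open>A\<close> in a member of the class. Domination by a sample point in each
  direction refers neither to \<open>E\<close> nor to maxima; for finite \<open>S\<close> and
  \<open>A\<close> it is a finite combination of inequalities, hence measurable in the
  points.\<close>

definition strict_hull :: "(real ^ 'd) set \<Rightarrow> (real ^ 'd) set \<Rightarrow> (real ^ 'd) set" where
  "strict_hull S A = {z. \<forall>u\<in>S. \<exists>a\<in>A. z \<bullet> u < a \<bullet> u}"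

text \<open>Indices rather than points, since \<open>num_interior\<close> counts coinciding sample
  points separately.\<close>

definition extremes :: "(real ^ 'd) set \<Rightarrow> 'i set \<Rightarrow> ('i \<Rightarrow> real ^ 'd) \<Rightarrow> 'i set" where
  "extremes S I x = {i \<in> I. x i \<notin> strict_hull S (x ` I)}"

lemma strict_hull_empty: "S \<noteq> {} \<Longrightarrow> strict_hull S {} = {}"
  unfolding strict_hull_def by auto

lemma extremes_subset: "extremes S I x \<subseteq> I"
  unfolding extremes_def by auto

text \<open>Strict domination is transitive, so points inside the hull add nothing to it.\<close>

lemma strict_hull_absorb:
  assumes "B \<subseteq> strict_hull S A"
  shows "strict_hull S (A \<union> B) = strict_hull S A"
proof
  show "strict_hull S (A \<union> B) \<subseteq> strict_hull S A"
  proof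
    fix z assume z: "z \<in> strict_hull S (A \<union> B)"
    show "z \<in> strict_hull S A"
      unfolding strict_hull_def
    proof (clarify)
      fix u assume u: "u \<in> S"
      obtain c where c: "c \<in> A \<union> B" "z \<bullet> u < c \<bullet> u"
        using z u unfolding strict_hull_def by blast
      show "\<exists>a\<in>A. z \<bullet> u < a \<bullet> u"
      proof (cases "c \<in> A")
        case False
        then have "c \<in> strict_hull S A" using c assms by auto
        then obtain a where "a \<in> A" "c \<bullet> u < a \<bullet> u"
          using u unfolding strict_hull_def by auto
        then show ?thesis using c by (intro bexI[of _ a]) auto
      qed (use c in auto)
    qed
  qed
qed (auto simp: strict_hull_def)

text \<open>A point attaining the maximum in some direction is not strictly dominated there, hence
  extreme; so the extreme points dominate whatever the sample dominates.\<close>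

lemma strict_hull_extremes:
  assumes "finite I"
  shows "strict_hull S (x ` extremes S I x) = strict_hull S (x ` I)"
proof
  show "strict_hull S (x ` I) \<subseteq> strict_hull S (x ` extremes S I x)"
  proof
    fix z assume z: "z \<in> strict_hull S (x ` I)"
    show "z \<in> strict_hull S (x ` extremes S I x)"
      unfolding strict_hull_def
    proof (clarify)
      fix u assume u: "u \<in> S"
      obtain i where i: "i \<in> I" "z \<bullet> u < x i \<bullet> u"
        using z u unfolding strict_hull_def by auto
      let ?m = "Max ((\<lambda>i. x i \<bullet> u) ` I)"
      have "?m \<in> (\<lambda>i. x i \<bullet> u) ` I"
        using i assms by (intro Max_in) auto
      then obtain j where j: "j \<in> I" "x j \<bullet> u = ?m" by auto
      then have max: "x k \<bullet> u \<le> x j \<bullet> u" if "k \<in> I" for k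
        using that assms by auto
      then have "x j \<notin> strict_hull S (x ` I)"
        using u unfolding strict_hull_def by (force simp: not_less)
      then have "j \<in> extremes S I x"
        using j by (simp add: extremes_def)
      then show "\<exists>a\<in>x ` extremes S I x. z \<bullet> u < a \<bullet> u"
        using i max[of i] by (intro bexI[of _ "x j"]) auto
    qed
  qed
qed (use extremes_subset[of S I x] in \<open>auto simp: strict_hull_def\<close>, blast)

lemma extremes_eq_self_iff:
  "extremes S I x = I \<longleftrightarrow> x ` I \<inter> strict_hull S (x ` I) = {}"
  unfolding extremes_def by auto

text \<open>The factorisation behind the conditioning: the right-hand side is a condition on the
  points in \<open>I\<close> alone, together with one separate condition for each remaining
  point.\<close>

lemma extremes_eq_iff:
  assumes "finite K" "I \<subseteq> K"
  shows "extremes S K x = I \<longleftrightarrow>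
    extremes S I x = I \<and> (\<forall>j\<in>K - I. x j \<in> strict_hull S (x ` I))"
proof
  assume I: "extremes S K x = I"
  then have "strict_hull S (x ` I) = strict_hull S (x ` K)"
    using strict_hull_extremes[OF assms(1), of S x] by simp
  then show "extremes S I x = I \<and> (\<forall>j\<in>K - I. x j \<in> strict_hull S (x ` I))"
    using I assms(2) by (auto simp: extremes_def)
next
  assume I: "extremes S I x = I \<and> (\<forall>j\<in>K - I. x j \<in> strict_hull S (x ` I))"
  then have "strict_hull S (x ` I \<union> x ` (K - I)) = strict_hull S (x ` I)"
    by (intro strict_hull_absorb) auto
  moreover have "x ` I \<union> x ` (K - I) = x ` K"
    using assms(2) by auto
  ultimately show "extremes S K x = I"
    using I assms(2) by (auto simp: extremes_def)
qed

lemma open_strict_hull: "finite S \<Longrightarrow> open (strict_hull S A)"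
proof -
  assume "finite S"
  moreover have "strict_hull S A = (\<Inter>u\<in>S. \<Union>a\<in>A. {z. u \<bullet> z < a \<bullet> u})"
    by (auto simp: strict_hull_def inner_commute)
  ultimately show ?thesis
    by (auto intro!: open_INT open_halfspace_lt)
qed

section \<open>The closed hull, its boundary and the wrapping hull\<close>

definition weak_hull :: "(real ^ 'd) set \<Rightarrow> (real ^ 'd) set \<Rightarrow> (real ^ 'd) set" where
  "weak_hull S A = {z. \<forall>u\<in>S. \<exists>a\<in>A. z \<bullet> u \<le> a \<bullet> u}"

lemma strict_hull_subset_weak_hull: "strict_hull S A \<subseteq> weak_hull S A"
proof
  fix z assume "z \<in> strict_hull S A"
  then have "\<exists>a\<in>A. z \<bullet> u \<le> a \<bullet> u" if "u \<in> S" for u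
    using that less_imp_le unfolding strict_hull_def by blast
  then show "z \<in> weak_hull S A"
    by (simp add: weak_hull_def)
qed

lemma weak_hull_eq_halfspaces:
  assumes "finite A" "A \<noteq> {}"
  shows "weak_hull S A = (\<Inter>u\<in>S. {x. x \<bullet> u \<le> Max ((\<lambda>a. a \<bullet> u) ` A)})"
  using assms by (auto simp: weak_hull_def Max_ge_iff)

lemma halfspaces_closed_convex:
  "closed (\<Inter>u\<in>S. {x. x \<bullet> u \<le> h u})" "convex (\<Inter>u\<in>S. {x :: real ^ 'd. x \<bullet> u \<le> h u})"
  by (auto simp: inner_commute[of _ "_ :: real ^ 'd"] closed_halfspace_le convex_halfspace_le
      intro!: closed_INT convex_INT)

lemma interior_weak_hull:
  assumes S: "finite S" "0 \<notin> S"
  shows "interior (weak_hull S A) = strict_hull S A"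
proof (rule interior_unique)
  show "strict_hull S A \<subseteq> weak_hull S A"
    by (rule strict_hull_subset_weak_hull)
  show "open (strict_hull S A)"
    by (rule open_strict_hull[OF S(1)])
  fix T assume T: "T \<subseteq> weak_hull S A" "open T"
  show "T \<subseteq> strict_hull S A"
    unfolding strict_hull_def
  proof clarify
    fix z u assume z: "z \<in> T" and u: "u \<in> S"
    then obtain e where e: "0 < e" "cball z e \<subseteq> T"
      using T(2) open_contains_cball by blast
    have u0: "0 < norm u" using u S(2) by auto
    \<comment> \<open>A step of length \<open>e\<close> along \<open>u\<close> stays in
      \<open>T\<close>, hence in the weak hull, but raises the inner product with \<open>u\<close>;
      this turns weak domination of \<open>z\<close> into strict domination.\<close>
    have "z + (e / norm u) *\<^sub>R u \<in> cball z e"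
      using e(1) u0 by (simp add: dist_norm)
    then have "z + (e / norm u) *\<^sub>R u \<in> weak_hull S A"
      using e(2) T(1) by blast
    then obtain a where a: "a \<in> A" "(z + (e / norm u) *\<^sub>R u) \<bullet> u \<le> a \<bullet> u"
      using u unfolding weak_hull_def by blast
    have "0 < (e / norm u) * (u \<bullet> u)"
      using e(1) u0 by (intro mult_pos_pos) auto
    then have "z \<bullet> u < a \<bullet> u"
      using a(2) by (simp add: inner_add_left)
    then show "\<exists>a\<in>A. z \<bullet> u < a \<bullet> u"
      using a(1) by blast
  qed
qed

text \<open>For nonempty \<open>A\<close> the difference is the frontier of a closed convex set,
  hence negligible. This lets the two hulls be exchanged under a uniform law.\<close>

lemma null_weak_hull_minus_strict_hull:
  assumes S: "finite S" "0 \<notin> S" and A: "finite A"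
  shows "weak_hull S A - strict_hull S A \<in> null_sets lborel"
proof (cases "A = {}")
  case True
  then show ?thesis by (auto simp: weak_hull_def strict_hull_def)
next
  case False
  note hs = weak_hull_eq_halfspaces[OF A False, of S]
  have cl: "closed (weak_hull S A)" and cv: "convex (weak_hull S A)"
    unfolding hs by (rule halfspaces_closed_convex)+
  have eq: "weak_hull S A - strict_hull S A = frontier (weak_hull S A)"
    using cl by (simp add: frontier_def interior_weak_hull[OF S])
  have "negligible (frontier (weak_hull S A))"
    by (rule negligible_convex_frontier[OF cv])
  then have "frontier (weak_hull S A) \<in> null_sets lebesgue"
    by (simp add: negligible_iff_null_sets)
  then show ?thesis
    unfolding eq by (simp add: null_sets_completion_iff)
qed

text \<open>The weak hull is the least member of the class that contains \<open>A\<close>. Its own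
  membership requires \<open>weak_hull S A \<subseteq> E\<close>, which \<open>P\<close> provides,
  being a member that contains \<open>A\<close>.\<close>

lemma wrapping_hull_eq:
  assumes P: "P \<in> polytope_class S E" and A: "finite A" "A \<noteq> {}" "A \<subseteq> P"
  shows "wrapping_hull S E A = weak_hull S A"
proof
  have "weak_hull S A \<subseteq> Q" if Q: "Q \<in> polytope_class S E" "A \<subseteq> Q" for Q
  proof -
    obtain h where h: "Q = (\<Inter>u\<in>S. {x. x \<bullet> u \<le> h u})"
      using Q(1) by (auto simp: polytope_class_def)
    show ?thesis
    proof
      fix z assume z: "z \<in> weak_hull S A"
      have "z \<bullet> u \<le> h u" if u: "u \<in> S" for u
      proof -
        obtain a where "a \<in> A" "z \<bullet> u \<le> a \<bullet> u"
          using z u by (auto simp: weak_hull_def)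
        moreover have "a \<bullet> u \<le> h u"
          using \<open>a \<in> A\<close> Q(2) u unfolding h by auto
        ultimately show ?thesis by simp
      qed
      then show "z \<in> Q" unfolding h by auto
    qed
  qed
  note sub = this
  show "weak_hull S A \<subseteq> wrapping_hull S E A"
    unfolding wrapping_hull_def using sub by blast
  have "weak_hull S A \<subseteq> E"
    using sub[OF P A(3)] P by (auto simp: polytope_class_def)
  moreover have "\<exists>h. weak_hull S A = (\<Inter>u\<in>S. {x. x \<bullet> u \<le> h u})"
    by (rule exI) (rule weak_hull_eq_halfspaces[OF A(1,2)])
  ultimately have "weak_hull S A \<in> polytope_class S E"
    by (simp add: polytope_class_def)
  moreover have "A \<subseteq> weak_hull S A"
    by (auto simp: weak_hull_def)
  ultimately show "wrapping_hull S E A \<subseteq> weak_hull S A"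
    unfolding wrapping_hull_def by blast
qed

lemma closed_wrapping_hull: "closed (wrapping_hull S E A)"
  unfolding wrapping_hull_def
  by (intro closed_Inter) (auto simp: polytope_class_def halfspaces_closed_convex)

lemma wrapping_hull_subset:
  "P \<in> polytope_class S E \<Longrightarrow> A \<subseteq> P \<Longrightarrow> wrapping_hull S E A \<subseteq> P"
  unfolding wrapping_hull_def by blast

section \<open>Conditioning on the extreme points\<close>

lemma measurable_count_pair:
  fixes p :: "nat pmf"
  assumes "\<And>n. f n \<in> borel_measurable N"
  shows "(\<lambda>(n, x). f n x) \<in> borel_measurable (measure_pmf p \<Otimes>\<^sub>M N)"
proof -
  have "(\<lambda>(n, x). f n x) \<in> borel_measurable (count_space UNIV \<Otimes>\<^sub>M N)"
    using assms by (intro measurable_pair_measure_countable1) auto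
  then show ?thesis
    by (simp cong: measurable_cong_sets sets_pair_measure_cong)
qed

locale iid_sample = prob_space M for M :: "(real ^ 'd) measure" +
  fixes S :: "(real ^ 'd) set"
  assumes sets_M[measurable_cong]: "sets M = sets borel" and finite_S: "finite S"
begin

sublocale P: product_prob_space "\<lambda>_ :: nat. M" UNIV
  by standard

abbreviation samples :: "nat set \<Rightarrow> (nat \<Rightarrow> real ^ 'd) measure" where
  "samples I \<equiv> PiM I (\<lambda>_. M)"

text \<open>For the uniform law on \<open>P\<close> this is the volume fraction \<open>v\<close> of
  the hull, as its boundary is null.\<close>

definition hull_mass :: "nat set \<Rightarrow> (nat \<Rightarrow> real ^ 'd) \<Rightarrow> real" where
  "hull_mass I x = prob (strict_hull S (x ` I))"

lemma strict_hull_in_sets[measurable, simp]: "strict_hull S A \<in> sets M"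
  using open_strict_hull[OF finite_S] by (simp add: sets_M)

lemma hull_mass_nonneg: "0 \<le> hull_mass I x" and hull_mass_le_1: "hull_mass I x \<le> 1"
  unfolding hull_mass_def by auto

lemma hull_mass_cong: "x ` I = y ` J \<Longrightarrow> hull_mass I x = hull_mass J y"
  unfolding hull_mass_def by simp

lemma pred_strict_hull:
  assumes I: "finite I" and X: "\<And>i. i \<in> I \<Longrightarrow> X i \<in> borel_measurable N" and [measurable]: "Z \<in> borel_measurable N"
  shows "Measurable.pred N (\<lambda>w. Z w \<in> strict_hull S ((\<lambda>i. X i w) ` I))"
proof -
  have "Measurable.pred N (\<lambda>w. Z w \<bullet> u < X i w \<bullet> u)" if "i \<in> I" for i u
    using X[OF that] by measurable
  then have "Measurable.pred N (\<lambda>w. \<forall>u\<in>S. \<exists>i\<in>I. Z w \<bullet> u < X i w \<bullet> u)"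
    using I finite_S by (intro pred_intros_finite) auto
  moreover have "(\<lambda>w. \<forall>u\<in>S. \<exists>i\<in>I. Z w \<bullet> u < X i w \<bullet> u) = (\<lambda>w. Z w \<in> strict_hull S ((\<lambda>i. X i w) ` I))"
    by (auto simp: strict_hull_def)
  ultimately show ?thesis by simp
qed

lemma measurable_component_borel:
  "i \<in> J \<Longrightarrow> (\<lambda>x. x i) \<in> borel_measurable (samples J)"
  using measurable_component_singleton[of i J "\<lambda>_. M"] measurable_cong_sets[OF refl sets_M] by blast

text \<open>The mass is the measure of a section of one measurable set in the product of the sample
  space with \<open>M\<close>.\<close>

lemma measurable_hull_mass[measurable]:
  assumes "finite I" "I \<subseteq> J"
  shows "hull_mass I \<in> borel_measurable (samples J)"
proof -
  have "Measurable.pred (samples J \<Otimes>\<^sub>M M) (\<lambda>w. snd w \<in> strict_hull S ((\<lambda>i. fst w i) ` I))"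
  proof (rule pred_strict_hull[OF assms(1), where X = "\<lambda>i w. fst w i" and Z = snd])
    fix i assume "i \<in> I"
    then show "(\<lambda>w. fst w i) \<in> borel_measurable (samples J \<Otimes>\<^sub>M M)"
      using measurable_compose[OF measurable_fst measurable_component_borel] assms(2) by blast
  next
    show "snd \<in> borel_measurable (samples J \<Otimes>\<^sub>M M)"
      using measurable_snd measurable_cong_sets[OF refl sets_M] by blast
  qed
  then have Q: "{w \<in> space (samples J \<Otimes>\<^sub>M M). snd w \<in> strict_hull S (fst w ` I)} \<in> sets (samples J \<Otimes>\<^sub>M M)" (is "?Q \<in> _")
    by measurable
  have "(\<lambda>x. measure M (Pair x -` ?Q)) \<in> borel_measurable (samples J)"
    unfolding measure_def using measurable_emeasure_Pair[OF Q] by measurable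
  moreover have "measure M (Pair x -` ?Q) = hull_mass I x" if "x \<in> space (samples J)" for x
  proof -
    have "Pair x -` ?Q = strict_hull S (x ` I)"
      using that sets.sets_into_space[OF strict_hull_in_sets] by (auto simp: space_pair_measure)
    then show ?thesis by (simp add: hull_mass_def)
  qed
  ultimately show ?thesis
    by (simp cong: measurable_cong)
qed

lemma pred_extremes_eq:
  assumes "finite I" "I \<subseteq> J"
  shows "Measurable.pred (samples J) (\<lambda>x. extremes S I x = A)"
proof -
  have "Measurable.pred (samples J) (\<lambda>x. x i \<in> strict_hull S ((\<lambda>i. x i) ` I))" if "i \<in> I" for i
    using that assms by (intro pred_strict_hull measurable_component_borel) auto
  then have "Measurable.pred (samples J) (\<lambda>x. A \<subseteq> I \<and> (\<forall>i\<in>I. i \<in> A \<longleftrightarrow> \<not> x i \<in> strict_hull S (x ` I)))"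
    using assms by (intro pred_intros_logic pred_intros_finite) auto
  moreover have "(\<lambda>x. A \<subseteq> I \<and> (\<forall>i\<in>I. i \<in> A \<longleftrightarrow> \<not> x i \<in> strict_hull S (x ` I))) = (\<lambda>x. extremes S I x = A)"
    by (auto simp: extremes_def fun_eq_iff)
  ultimately show ?thesis by simp
qed

lemma sum_extremes_eq:
  fixes f :: "nat set \<Rightarrow> ennreal"
  assumes "finite K"
  shows "(\<Sum>I\<in>Pow K. indicator {x. extremes S K x = I} x * f I) = f (extremes S K x)"
proof -
  have "(\<Sum>I\<in>Pow K. indicator {x. extremes S K x = I} x * f I)
      = (\<Sum>I\<in>{extremes S K x}. indicator {x. extremes S K x = I} x * f I)"
    using assms extremes_subset[of S K x] by (intro sum.mono_neutral_right) (auto simp: indicator_def)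
  then show ?thesis by simp
qed

lemma measurable_extremes_card:
  assumes "finite K" "K \<subseteq> J" and F: "\<And>j. F j \<in> borel_measurable borel"
  shows "(\<lambda>x. F (card (extremes S K x)) (hull_mass K x) :: ennreal) \<in> borel_measurable (samples J)"
proof -
  have "F (card (extremes S K x)) (hull_mass K x)
    = (\<Sum>I\<in>Pow K. indicator {x. extremes S K x = I} x * F (card I) (hull_mass K x))" for x
    by (rule sum_extremes_eq[OF assms(1), of x "\<lambda>I. F (card I) (hull_mass K x)", symmetric])
  moreover have "(\<lambda>x. indicator {x. extremes S K x = I} x * F (card I) (hull_mass K x))
      \<in> borel_measurable (samples J)" for I
  proof -
    note [measurable] = pred_extremes_eq[OF assms(1,2), of I] measurable_hull_mass[OF assms(1,2)] F
    have "(\<lambda>x. (if extremes S K x = I then 1 else 0) * F (card I) (hull_mass K x)) \<in> borel_measurable (samples J)"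
      by measurable
    then show ?thesis by (simp add: indicator_def)
  qed
  ultimately show ?thesis
    by (simp add: borel_measurable_sum)
qed

text \<open>Integrates over the extreme points only: the other points are integrated out beforehand
  and enter through \<open>g\<close>, as powers of the hull mass.\<close>

definition core :: "nat set \<Rightarrow> (real \<Rightarrow> ennreal) \<Rightarrow> ennreal" where
  "core I g = (\<integral>\<^sup>+x. indicator {x. extremes S I x = I} x * g (hull_mass I x) \<partial>samples I)"

text \<open>Exchangeability of i.i.d. points: only the number of indices matters, which later
  collects index sets into binomial coefficients.\<close>

lemma core_reindex:
  assumes g[measurable]: "g \<in> borel_measurable borel" and I: "finite I"
  shows "core I g = core {..<card I} g"
proof -
  obtain h where h: "bij_betw h {..<card I} I"
    using ex_bij_betw_nat_finite[OF I] by (auto simp: atLeast0LessThan)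
  let ?J = "{..<card I}"
  let ?t = "\<lambda>\<omega>. \<lambda>n\<in>?J. \<omega> (h n)"
  have distr: "distr (samples I) (samples ?J) ?t = samples ?J"
    using distr_PiM_reindex[of I "\<lambda>_. M" h ?J] h prob_space_axioms
    by (auto simp: bij_betw_def)
  have t[measurable]: "?t \<in> measurable (samples I) (samples ?J)"
    using h by (intro measurable_restrict measurable_component_singleton) (auto simp: bij_betw_def)
  note [measurable] = pred_extremes_eq[of ?J ?J ?J, simplified] measurable_hull_mass[of ?J ?J, simplified]
  have img: "?t \<omega> ` ?J = \<omega> ` I" for \<omega> :: "nat \<Rightarrow> real ^ 'd"
  proof -
    have "?t \<omega> ` ?J = \<omega> ` h ` ?J"
      by (simp add: image_image)
    then show ?thesis
      using bij_betw_imp_surj_on[OF h] by simp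
  qed
  have "core ?J g = (\<integral>\<^sup>+x. (if extremes S ?J x = ?J then 1 else 0) * g (hull_mass ?J x) \<partial>distr (samples I) (samples ?J) ?t)"
    unfolding core_def distr by (simp add: indicator_def of_bool_def)
  also have "\<dots> = (\<integral>\<^sup>+x. (if extremes S ?J (?t x) = ?J then 1 else 0) * g (hull_mass ?J (?t x)) \<partial>samples I)"
    using t by (intro nn_integral_distr) (auto simp: measurable_distr_eq1)
  also have "\<dots> = core I g"
    unfolding core_def extremes_eq_self_iff img hull_mass_cong[OF img]
    by (simp add: indicator_def of_bool_def)
  finally show ?thesis ..
qed

text \<open>Split by the extreme index set \<open>I\<close> and integrate the points outside
  \<open>I\<close> first. By \<open>extremes_eq_iff\<close> each of them must fall into the strict
  hull of the points in \<open>I\<close>, independently and with probability \<open>v\<close>; this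
  yields the factor \<open>v ^ card (K - I)\<close>.\<close>

lemma nn_integral_samples_extremes:
  assumes K: "finite K" and F: "\<And>j. F j \<in> borel_measurable borel"
  shows "(\<integral>\<^sup>+x. F (card (extremes S K x)) (hull_mass K x) \<partial>samples K)
    = (\<Sum>I\<in>Pow K. core I (\<lambda>v. F (card I) v * ennreal (v ^ card (K - I))))"
proof -
  have "(\<integral>\<^sup>+x. F (card (extremes S K x)) (hull_mass K x) \<partial>samples K)
      = (\<integral>\<^sup>+x. (\<Sum>I\<in>Pow K. indicator {x. extremes S K x = I} x * F (card I) (hull_mass K x)) \<partial>samples K)"
    by (intro nn_integral_cong sum_extremes_eq[OF K, symmetric])
  also have "\<dots> = (\<Sum>I\<in>Pow K. \<integral>\<^sup>+x. indicator {x. extremes S K x = I} x * F (card I) (hull_mass K x) \<partial>samples K)"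
  proof (intro nn_integral_sum)
    fix I
    note [measurable] = pred_extremes_eq[OF K order_refl, of I] measurable_hull_mass[OF K order_refl] F
    have "(\<lambda>x. (if extremes S K x = I then 1 else 0) * F (card I) (hull_mass K x)) \<in> borel_measurable (samples K)"
      by measurable
    then show "(\<lambda>x. indicator {x. extremes S K x = I} x * F (card I) (hull_mass K x)) \<in> borel_measurable (samples K)"
      by (simp add: indicator_def)
  qed
  also have "\<dots> = (\<Sum>I\<in>Pow K. core I (\<lambda>v. F (card I) v * ennreal (v ^ card (K - I))))"
  proof (intro sum.cong refl)
    fix I assume "I \<in> Pow K"
    then have IK: "I \<subseteq> K" and fin: "finite I" "finite (K - I)" and un: "I \<union> (K - I) = K"
      using K finite_subset by auto
    let ?f = "\<lambda>x. indicator {x. extremes S K x = I} x * F (card I) (hull_mass I x)"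
    have f: "?f \<in> borel_measurable (samples K)"
    proof -
      note [measurable] = pred_extremes_eq[OF K order_refl, of I] measurable_hull_mass[OF fin(1) IK] F
      have "(\<lambda>x. (if extremes S K x = I then 1 else 0) * F (card I) (hull_mass I x)) \<in> borel_measurable (samples K)"
        by measurable
      then show ?thesis
        by (simp add: indicator_def)
    qed
    \<comment> \<open>On this event the points in \<open>I\<close> generate the whole hull, so its
      mass depends on them alone.\<close>
    have "(\<integral>\<^sup>+x. indicator {x. extremes S K x = I} x * F (card I) (hull_mass K x) \<partial>samples K)
        = (\<integral>\<^sup>+x. ?f x \<partial>samples K)"
      using strict_hull_extremes[OF K, of S]
      by (intro nn_integral_cong) (auto simp: indicator_def hull_mass_def)
    also have "\<dots> = (\<integral>\<^sup>+x. \<integral>\<^sup>+y. ?f (merge I (K - I) (x, y)) \<partial>samples (K - I) \<partial>samples I)"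
      using P.product_nn_integral_fold[of I "K - I" ?f] fin f un by auto
    also have "\<dots> = core I (\<lambda>v. F (card I) v * ennreal (v ^ card (K - I)))"
      unfolding core_def
    proof (intro nn_integral_cong)
      fix x
      let ?c = "indicator {x. extremes S I x = I} x * F (card I) (hull_mass I x)"
      let ?B = "PiE (K - I) (\<lambda>_. strict_hull S (x ` I))"
      have img: "merge I (K - I) (x, y) ` I = x ` I" for y
        by (auto simp: merge_def)
      have "(\<integral>\<^sup>+y. ?f (merge I (K - I) (x, y)) \<partial>samples (K - I)) = (\<integral>\<^sup>+y. ?c * indicator ?B y \<partial>samples (K - I))"
      proof (intro nn_integral_cong)
        fix y assume "y \<in> space (samples (K - I))"
        then have "y \<in> extensional (K - I)"
          by (auto simp: space_PiM PiE_def)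
        then have "extremes S K (merge I (K - I) (x, y)) = I \<longleftrightarrow> extremes S I x = I \<and> y \<in> ?B"
          unfolding extremes_eq_iff[OF K IK] extremes_eq_self_iff img
          by (auto simp: PiE_def Pi_def merge_def)
        then show "?f (merge I (K - I) (x, y)) = ?c * indicator ?B y"
          using hull_mass_cong[OF img[of y]] by (auto simp: indicator_def)
      qed
      also have "\<dots> = ?c * emeasure (samples (K - I)) ?B"
        using fin by (intro nn_integral_cmult_indicator sets_PiM_I_finite) auto
      also have "emeasure (samples (K - I)) ?B = ennreal (hull_mass I x ^ card (K - I))"
        using fin by (subst P.emeasure_PiM) (auto simp: emeasure_eq_measure hull_mass_def ennreal_power)
      finally show "(\<integral>\<^sup>+y. ?f (merge I (K - I) (x, y)) \<partial>samples (K - I))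
          = indicator {x. extremes S I x = I} x * (F (card I) (hull_mass I x) * ennreal (hull_mass I x ^ card (K - I)))"
        by (simp add: mult.assoc)
    qed
    finally show "(\<integral>\<^sup>+x. indicator {x. extremes S K x = I} x * F (card I) (hull_mass K x) \<partial>samples K)
        = core I (\<lambda>v. F (card I) v * ennreal (v ^ card (K - I)))" .
  qed
  finally show ?thesis .
qed

text \<open>The arguments of \<open>F\<close> are the Poisson sample size, the number of extreme
  points and the mass of their hull; every term of the risk bound is a function of these
  three.\<close>

definition model_mean :: "real \<Rightarrow> (nat \<Rightarrow> nat \<Rightarrow> real \<Rightarrow> ennreal) \<Rightarrow> ennreal" where
  "model_mean m F = poisson_mean m (\<lambda>n. \<integral>\<^sup>+x. F n (card (extremes S {..<n} x)) (hull_mass {..<n} x) \<partial>samples UNIV)"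

lemma nn_integral_samples_UNIV_extremes:
  assumes F[measurable]: "\<And>j. F j \<in> borel_measurable borel"
  shows "(\<integral>\<^sup>+x. F (card (extremes S {..<n} x)) (hull_mass {..<n} x) \<partial>samples UNIV)
    = (\<Sum>j\<le>n. of_nat (n choose j) * core {..<j} (\<lambda>v. F j v * ennreal (v ^ (n - j))))"
proof -
  let ?K = "{..<n}"
  have distr: "distr (samples UNIV) (samples ?K) (\<lambda>x. restrict x ?K) = samples ?K"
    by (rule distr_PiM_reindex) (auto intro: prob_space_axioms)
  have restr: "extremes S ?K (restrict x ?K) = extremes S ?K x" "hull_mass ?K (restrict x ?K) = hull_mass ?K x" for x
  proof -
    show "hull_mass ?K (restrict x ?K) = hull_mass ?K x"
      by (rule hull_mass_cong) (rule image_restrict_eq)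
    show "extremes S ?K (restrict x ?K) = extremes S ?K x"
      unfolding extremes_def image_restrict_eq by (rule Collect_cong) auto
  qed
  have "(\<integral>\<^sup>+x. F (card (extremes S ?K x)) (hull_mass ?K x) \<partial>samples UNIV)
      = (\<integral>\<^sup>+x. F (card (extremes S ?K x)) (hull_mass ?K x) \<partial>distr (samples UNIV) (samples ?K) (\<lambda>x. restrict x ?K))"
  proof (subst nn_integral_distr)
    show "(\<lambda>x. F (card (extremes S ?K x)) (hull_mass ?K x))
        \<in> borel_measurable (distr (samples UNIV) (samples ?K) (\<lambda>x. restrict x ?K))"
      unfolding distr by (rule measurable_extremes_card[OF _ order_refl F]) simp
    show "(\<lambda>x. restrict x ?K) \<in> samples UNIV \<rightarrow>\<^sub>M samples ?K"
      by (rule measurable_restrict_subset) simp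
  qed (simp only: restr)
  also have "\<dots> = (\<Sum>I\<in>Pow ?K. core I (\<lambda>v. F (card I) v * ennreal (v ^ card (?K - I))))"
    unfolding distr by (intro nn_integral_samples_extremes F) auto
  also have "\<dots> = (\<Sum>I\<in>Pow ?K. core {..<card I} (\<lambda>v. F (card I) v * ennreal (v ^ (n - card I))))"
  proof (intro sum.cong refl)
    fix I assume "I \<in> Pow ?K"
    then have "I \<subseteq> ?K" by simp
    then have "finite I"
      using finite_subset by blast
    moreover have "card (?K - I) = n - card I"
      using \<open>I \<subseteq> ?K\<close> \<open>finite I\<close> by (simp add: card_Diff_subset)
    ultimately show "core I (\<lambda>v. F (card I) v * ennreal (v ^ card (?K - I)))
        = core {..<card I} (\<lambda>v. F (card I) v * ennreal (v ^ (n - card I)))"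
      using core_reindex[of "\<lambda>v. F (card I) v * ennreal (v ^ (n - card I))" I] by simp
  qed
  also have "\<dots> = (\<Sum>j\<le>n. \<Sum>I\<in>{I \<in> Pow ?K. card I = j}. core {..<card I} (\<lambda>v. F (card I) v * ennreal (v ^ (n - card I))))"
  proof (rule sum.group[symmetric])
    show "card ` Pow ?K \<subseteq> {..n}"
    proof
      fix j assume "j \<in> card ` Pow ?K"
      then obtain I where "I \<subseteq> ?K" "j = card I"
        by auto
      then show "j \<in> {..n}"
        using card_mono[of ?K I] by simp
    qed
  qed auto
  also have "\<dots> = (\<Sum>j\<le>n. of_nat (n choose j) * core {..<j} (\<lambda>v. F j v * ennreal (v ^ (n - j))))"
  proof (intro sum.cong refl)
    fix j
    have "card {I \<in> Pow ?K. card I = j} = n choose j"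
      using n_subsets[of ?K j] by simp
    then show "(\<Sum>I\<in>{I \<in> Pow ?K. card I = j}. core {..<card I} (\<lambda>v. F (card I) v * ennreal (v ^ (n - card I))))
        = of_nat (n choose j) * core {..<j} (\<lambda>v. F j v * ennreal (v ^ (n - j)))"
      by simp
  qed
  finally show ?thesis .
qed

lemma core_cmult:
  assumes [measurable]: "g \<in> borel_measurable borel"
  shows "core {..<j} (\<lambda>v. c * g v) = c * core {..<j} g"
proof -
  note [measurable] = pred_extremes_eq[of "{..<j}" "{..<j}" "{..<j}", simplified] measurable_hull_mass[of "{..<j}" "{..<j}", simplified]
  have "c * core {..<j} g = (\<integral>\<^sup>+x. c * ((if extremes S {..<j} x = {..<j} then 1 else 0) * g (hull_mass {..<j} x)) \<partial>samples {..<j})"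
    unfolding core_def by (subst nn_integral_cmult) (auto simp: indicator_def of_bool_def)
  also have "\<dots> = core {..<j} (\<lambda>v. c * g v)"
    unfolding core_def by (intro nn_integral_cong) (auto simp: indicator_def)
  finally show ?thesis ..
qed

lemma core_suminf:
  assumes [measurable]: "\<And>l. g l \<in> borel_measurable borel"
  shows "core {..<j} (\<lambda>v. \<Sum>l. g l v) = (\<Sum>l. core {..<j} (g l))"
proof -
  note [measurable] = pred_extremes_eq[of "{..<j}" "{..<j}" "{..<j}", simplified] measurable_hull_mass[of "{..<j}" "{..<j}", simplified]
  have "(\<Sum>l. core {..<j} (g l)) = (\<integral>\<^sup>+x. (\<Sum>l. (if extremes S {..<j} x = {..<j} then 1 else 0) * g l (hull_mass {..<j} x)) \<partial>samples {..<j})"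
    unfolding core_def by (subst nn_integral_suminf) (auto simp: indicator_def of_bool_def)
  also have "\<dots> = core {..<j} (\<lambda>v. \<Sum>l. g l v)"
    unfolding core_def by (intro nn_integral_cong) (auto simp: indicator_def)
  finally show ?thesis ..
qed

lemma core_cong:
  "(\<And>v. 0 \<le> v \<Longrightarrow> v \<le> 1 \<Longrightarrow> f v = g v) \<Longrightarrow> core I f = core I g"
  unfolding core_def by (intro nn_integral_cong) (simp add: hull_mass_nonneg hull_mass_le_1)

text \<open>With \<open>n = j + l\<close>, \<open>m ^ n / fact n * (n choose j) * v ^ l = m ^ j /
  fact j * ((m * v) ^ l / fact l)\<close>, and \<open>exp (- m)\<close> splits into factors for
  \<open>m * (1 - v)\<close> and \<open>m * v\<close>. So the sum over \<open>l\<close> is a Poisson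
  mean with parameter \<open>m * v\<close>.\<close>

lemma model_mean_eq_core:
  assumes m: "0 \<le> m" and F[measurable]: "\<And>n j. F n j \<in> borel_measurable borel"
  shows "model_mean m F = (\<Sum>j. core {..<j} (\<lambda>v. ennreal (m ^ j / fact j * exp (- (m * (1 - v))))
    * poisson_mean (m * v) (\<lambda>l. F (j + l) j v)))"
proof -
  let ?w = "\<lambda>n. ennreal (m ^ n / fact n * exp (- m))"
  define a where "a j l = ?w (j + l) * (of_nat ((j + l) choose j) * core {..<j} (\<lambda>v. F (j + l) j v * ennreal (v ^ l)))" for j l
  have "model_mean m F = (\<Sum>n. \<Sum>j\<le>n. a j (n - j))"
    unfolding model_mean_def poisson_mean_def
  proof (rule suminf_cong)
    fix n
    have "?w n * (\<integral>\<^sup>+x. F n (card (extremes S {..<n} x)) (hull_mass {..<n} x) \<partial>samples UNIV)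
        = (\<Sum>j\<le>n. ?w n * (of_nat (n choose j) * core {..<j} (\<lambda>v. F n j v * ennreal (v ^ (n - j)))))"
      by (subst nn_integral_samples_UNIV_extremes[OF F]) (rule sum_distrib_left)
    also have "\<dots> = (\<Sum>j\<le>n. a j (n - j))"
      by (rule sum.cong) (auto simp: a_def)
    finally show "?w n * (\<integral>\<^sup>+x. F n (card (extremes S {..<n} x)) (hull_mass {..<n} x) \<partial>samples UNIV)
        = (\<Sum>j\<le>n. a j (n - j))" .
  qed
  also have "\<dots> = (\<Sum>j. \<Sum>l. a j l)"
    by (rule suminf_ennreal_triangle)
  also have "\<dots> = (\<Sum>j. core {..<j} (\<lambda>v. ennreal (m ^ j / fact j * exp (- (m * (1 - v))))
    * poisson_mean (m * v) (\<lambda>l. F (j + l) j v)))"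
  proof (rule suminf_cong)
    fix j
    have "a j l = core {..<j} (\<lambda>v. ennreal (m ^ j / fact j * exp (- (m * (1 - v))))
        * (ennreal ((m * v) ^ l / fact l * exp (- (m * v))) * F (j + l) j v))" for l
    proof -
      have "a j l = core {..<j} (\<lambda>v. (?w (j + l) * of_nat ((j + l) choose j)) * (F (j + l) j v * ennreal (v ^ l)))"
        unfolding a_def by (subst core_cmult) (auto simp: mult.assoc)
      also have "\<dots> = core {..<j} (\<lambda>v. ennreal (m ^ j / fact j * exp (- (m * (1 - v))))
        * (ennreal ((m * v) ^ l / fact l * exp (- (m * v))) * F (j + l) j v))"
      proof (rule core_cong)
        fix v :: real assume v: "0 \<le> v" "v \<le> 1"
        have eq: "m ^ (j + l) / fact (j + l) * exp (- m) * real ((j + l) choose j) * v ^ l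
            = (m ^ j / fact j * exp (- (m * (1 - v)))) * ((m * v) ^ l / fact l * exp (- (m * v)))"
        proof -
          have b: "real ((j + l) choose j) / fact (j + l) = 1 / (fact j * fact l)"
            by (simp add: binomial_fact)
          have e: "exp (- m) = exp (- (m * (1 - v))) * exp (- (m * v))"
            by (simp add: exp_add[symmetric] algebra_simps)
          have "m ^ (j + l) / fact (j + l) * exp (- m) * real ((j + l) choose j) * v ^ l
              = (real ((j + l) choose j) / fact (j + l)) * (m ^ j * m ^ l) * exp (- m) * v ^ l"
            by (simp add: power_add)
          also have "\<dots> = 1 / (fact j * fact l) * (m ^ j * m ^ l)
              * (exp (- (m * (1 - v))) * exp (- (m * v))) * v ^ l"
            by (simp only: b e)
          finally show ?thesis
            by (simp add: power_mult_distrib)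
        qed
        have "?w (j + l) * of_nat ((j + l) choose j) * ennreal (v ^ l)
            = ennreal (m ^ j / fact j * exp (- (m * (1 - v)))) * ennreal ((m * v) ^ l / fact l * exp (- (m * v)))"
        proof -
          have "0 \<le> m ^ (j + l) / fact (j + l) * exp (- m)" "0 \<le> m ^ j / fact j * exp (- (m * (1 - v)))"
            "0 \<le> (m * v) ^ l / fact l * exp (- (m * v))" "0 \<le> v ^ l"
            using m v by auto
          with eq show ?thesis
            by (simp only: ennreal_of_nat_eq_real_of_nat ennreal_mult[symmetric] mult_nonneg_nonneg of_nat_0_le_iff)
        qed
        then have *: "?w (j + l) * of_nat ((j + l) choose j) * ennreal (v ^ l) * F (j + l) j v
            = ennreal (m ^ j / fact j * exp (- (m * (1 - v)))) * ennreal ((m * v) ^ l / fact l * exp (- (m * v))) * F (j + l) j v"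
          by (rule arg_cong)
        show "?w (j + l) * of_nat ((j + l) choose j) * (F (j + l) j v * ennreal (v ^ l))
            = ennreal (m ^ j / fact j * exp (- (m * (1 - v)))) * (ennreal ((m * v) ^ l / fact l * exp (- (m * v))) * F (j + l) j v)"
          by (subst mult.commute[of "F (j + l) j v"]) (use * in \<open>simp only: mult.assoc\<close>)
      qed
      finally show ?thesis .
    qed
    moreover have meas: "(\<lambda>v. ennreal (m ^ j / fact j * exp (- (m * (1 - v))))
        * (ennreal ((m * v) ^ l / fact l * exp (- (m * v))) * F (j + l) j v)) \<in> borel_measurable borel" for l
      by measurable
    ultimately have "(\<Sum>l. a j l) = core {..<j} (\<lambda>v. \<Sum>l. ennreal (m ^ j / fact j * exp (- (m * (1 - v))))
        * (ennreal ((m * v) ^ l / fact l * exp (- (m * v))) * F (j + l) j v))"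
      by (simp only: core_suminf[OF meas])
    then show "(\<Sum>l. a j l) = core {..<j} (\<lambda>v. ennreal (m ^ j / fact j * exp (- (m * (1 - v))))
        * poisson_mean (m * v) (\<lambda>l. F (j + l) j v))"
      by (simp add: poisson_mean_def)
  qed
  finally show ?thesis .
qed

text \<open>Rao--Blackwell: given the extreme points, the number of points inside the hull is Poisson
  with mean proportional to the mass \<open>v\<close> of the hull.\<close>

lemma model_mean_condition:
  assumes m: "0 \<le> m" and F[measurable]: "\<And>n j. F n j \<in> borel_measurable borel"
  shows "model_mean m F = model_mean m (\<lambda>n j v. poisson_mean (m * v) (\<lambda>l. F (j + l) j v))"
proof -
  have "(\<lambda>v. poisson_mean (m * v) (\<lambda>l. F (j + l) j v)) \<in> borel_measurable borel" for j
    unfolding poisson_mean_def by measurable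
  then have "model_mean m (\<lambda>n j v. poisson_mean (m * v) (\<lambda>l. F (j + l) j v))
      = (\<Sum>j. core {..<j} (\<lambda>v. ennreal (m ^ j / fact j * exp (- (m * (1 - v))))
        * poisson_mean (m * v) (\<lambda>_. poisson_mean (m * v) (\<lambda>l. F (j + l) j v))))"
    by (intro model_mean_eq_core m)
  \<comment> \<open>The averaged function does not depend on \<open>l\<close>, so averaging it once
    more changes nothing and both sides have the same expansion.\<close>
  also have "\<dots> = (\<Sum>j. core {..<j} (\<lambda>v. ennreal (m ^ j / fact j * exp (- (m * (1 - v))))
        * poisson_mean (m * v) (\<lambda>l. F (j + l) j v)))"
  proof (rule suminf_cong, rule core_cong)
    fix j and v :: real assume "0 \<le> v"
    then have "0 \<le> m * v"
      using m by simp
    then show "ennreal (m ^ j / fact j * exp (- (m * (1 - v))))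
        * poisson_mean (m * v) (\<lambda>_. poisson_mean (m * v) (\<lambda>l. F (j + l) j v))
      = ennreal (m ^ j / fact j * exp (- (m * (1 - v)))) * poisson_mean (m * v) (\<lambda>l. F (j + l) j v)"
      by (simp only: poisson_mean_const)
  qed
  also have "\<dots> = model_mean m F"
    by (rule model_mean_eq_core[OF m F, symmetric])
  finally show ?thesis ..
qed

lemma card_extremes_le: "card (extremes S {..<n} x) \<le> n"
  using card_mono[OF _ extremes_subset[of S "{..<n}" x]] by simp

lemma model_mean_mono_AE:
  assumes "AE x in samples UNIV. \<forall>n. F n (card (extremes S {..<n} x)) (hull_mass {..<n} x)
    \<le> G n (card (extremes S {..<n} x)) (hull_mass {..<n} x)"
  shows "model_mean m F \<le> model_mean m G"
  unfolding model_mean_def using assms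
  by (intro poisson_mean_mono nn_integral_mono_AE) (auto elim: eventually_mono)

lemma model_mean_mono:
  assumes "\<And>n j v. j \<le> n \<Longrightarrow> 0 \<le> v \<Longrightarrow> v \<le> 1 \<Longrightarrow> F n j v \<le> G n j v"
  shows "model_mean m F \<le> model_mean m G"
  using assms by (intro model_mean_mono_AE) (simp add: card_extremes_le hull_mass_nonneg hull_mass_le_1)

lemma model_mean_cong:
  assumes "\<And>n j v. j \<le> n \<Longrightarrow> 0 \<le> v \<Longrightarrow> v \<le> 1 \<Longrightarrow> F n j v = G n j v"
  shows "model_mean m F = model_mean m G"
  using assms by (intro antisym model_mean_mono) auto

lemma measurable_model:
  assumes "\<And>n j. F n j \<in> borel_measurable borel"
  shows "(\<lambda>x. F n (card (extremes S {..<n} x)) (hull_mass {..<n} x) :: ennreal) \<in> borel_measurable (samples UNIV)"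
  using assms by (intro measurable_extremes_card) auto

lemma model_mean_add:
  assumes "\<And>n j. F n j \<in> borel_measurable borel" "\<And>n j. G n j \<in> borel_measurable borel"
  shows "model_mean m (\<lambda>n j v. F n j v + G n j v) = model_mean m F + model_mean m G"
  unfolding model_mean_def poisson_mean_add[symmetric]
  by (intro arg_cong[of _ _ "poisson_mean m"] ext nn_integral_add measurable_model assms)

lemma model_mean_cmult:
  assumes "\<And>n j. F n j \<in> borel_measurable borel"
  shows "model_mean m (\<lambda>n j v. c * F n j v) = c * model_mean m F"
  unfolding model_mean_def poisson_mean_cmult[symmetric]
  by (intro arg_cong[of _ _ "poisson_mean m"] ext nn_integral_cmult measurable_model assms)

lemma model_mean_count: "model_mean m (\<lambda>n j v. f n) = poisson_mean m f"
  unfolding model_mean_def by (simp add: P.emeasure_space_1)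

text \<open>Since \<open>j + m * v\<close> is the conditional mean of the total count given the hull, the variance
  of the count splits into the mean of \<open>m * v\<close> and the left-hand side.\<close>

lemma model_mean_score_square:
  assumes m: "0 \<le> m"
  shows "model_mean m (\<lambda>n j v. ennreal ((real j + m * v - m)\<^sup>2)) = model_mean m (\<lambda>n j v. of_nat j)"
proof -
  have "ennreal m = model_mean m (\<lambda>n j v. of_nat n)"
    by (simp add: model_mean_count poisson_mean_of_nat m)
  also have "\<dots> = model_mean m (\<lambda>n j v. poisson_mean (m * v) (\<lambda>l. of_nat (j + l)))"
    by (intro model_mean_condition m) simp
  also have "\<dots> = model_mean m (\<lambda>n j v. of_nat j + ennreal (m * v))"
    using m by (intro model_mean_cong)
      (simp add: poisson_mean_add poisson_mean_const poisson_mean_of_nat)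
  also have "\<dots> = model_mean m (\<lambda>n j v. of_nat j) + model_mean m (\<lambda>n j v. ennreal (m * v))"
    by (intro model_mean_add) auto
  finally have 1: "ennreal m = model_mean m (\<lambda>n j v. of_nat j) + model_mean m (\<lambda>n j v. ennreal (m * v))" .
  have "ennreal m = model_mean m (\<lambda>n j v. ennreal ((real n - m)\<^sup>2))"
    using poisson_mean_shifted_square[OF m, of "- m"] by (simp add: model_mean_count)
  also have "\<dots> = model_mean m (\<lambda>n j v. poisson_mean (m * v) (\<lambda>l. ennreal ((real (j + l) - m)\<^sup>2)))"
    by (intro model_mean_condition m) simp
  also have "\<dots> = model_mean m (\<lambda>n j v. ennreal ((real j + m * v - m)\<^sup>2) + ennreal (m * v))"
  proof (intro model_mean_cong)
    fix j and v :: real assume "0 \<le> v"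
    then have "0 \<le> m * v" using m by simp
    then show "poisson_mean (m * v) (\<lambda>l. ennreal ((real (j + l) - m)\<^sup>2))
        = ennreal ((real j + m * v - m)\<^sup>2) + ennreal (m * v)"
      using poisson_mean_shifted_square[of "m * v" "real j - m"]
      by (simp add: algebra_simps ennreal_plus[symmetric] del: ennreal_plus)
  qed
  also have "\<dots> = model_mean m (\<lambda>n j v. ennreal ((real j + m * v - m)\<^sup>2)) + model_mean m (\<lambda>n j v. ennreal (m * v))"
    by (intro model_mean_add) auto
  finally have 2: "ennreal m = \<dots>" .
  \<comment> \<open>Mean and variance of the sample size are both \<open>m\<close>. The two
    expansions share the mean of \<open>m * v\<close>, which may be cancelled because it is
    finite.\<close>
  have "model_mean m (\<lambda>n j v. ennreal (m * v)) \<le> ennreal m"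
    by (subst 1) simp
  then have "model_mean m (\<lambda>n j v. ennreal (m * v)) \<noteq> \<top>"
    using ennreal_less_top[of m] by (auto simp: top_unique)
  then show ?thesis
    using 1 2 by (simp add: ennreal_add_left_cancel add.commute[of _ "model_mean m (\<lambda>n j v. ennreal (m * v))"])
qed

section \<open>Almost sure bound on the number of extreme points\<close>

lemma card_extremes_le_directions:
  assumes "\<And>i j u. i < n \<Longrightarrow> j < n \<Longrightarrow> i \<noteq> j \<Longrightarrow> u \<in> S \<Longrightarrow> x i \<bullet> u \<noteq> x j \<bullet> u"
  shows "card (extremes S {..<n} x) \<le> card S"
proof -
  have "\<forall>i\<in>extremes S {..<n} x. \<exists>u\<in>S. \<forall>k<n. x k \<bullet> u \<le> x i \<bullet> u"
    by (auto simp: extremes_def strict_hull_def not_less)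
  then obtain U where U: "\<And>i. i \<in> extremes S {..<n} x \<Longrightarrow> U i \<in> S"
    "\<And>i k. i \<in> extremes S {..<n} x \<Longrightarrow> k < n \<Longrightarrow> x k \<bullet> U i \<le> x i \<bullet> U i"
    by metis
  have "inj_on U (extremes S {..<n} x)"
  proof (rule inj_onI, rule ccontr)
    fix i j assume ij: "i \<in> extremes S {..<n} x" "j \<in> extremes S {..<n} x" "U i = U j" "i \<noteq> j"
    then have "i < n" "j < n" using extremes_subset[of S "{..<n}" x] by auto
    then show False
      using assms[of i j "U i"] U(1)[of i] U(2)[of i j] U(2)[of j i] ij by auto
  qed
  then show ?thesis
    using U(1) finite_S by (intro card_inj_on_le[of U]) auto
qed

text \<open>Fubini for the pair \<open>x i\<close>, \<open>x j\<close>: once \<open>x j\<close> is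
  fixed, a tie in direction \<open>u\<close> puts \<open>x i\<close> on a hyperplane of mass 0.
  There are countably many pairs and finitely many directions.\<close>

lemma AE_no_ties:
  assumes null: "\<And>u t. u \<in> S \<Longrightarrow> emeasure M {z. z \<bullet> u = t} = 0"
  shows "AE x in samples UNIV. \<forall>i j. \<forall>u\<in>S. i \<noteq> j \<longrightarrow> x i \<bullet> u \<noteq> x j \<bullet> u"
proof -
  have "AE x in samples UNIV. x i \<bullet> u \<noteq> x j \<bullet> u" if ij: "i \<noteq> j" and u: "u \<in> S" for i j u
  proof -
    let ?J = "insert i {j}"
    have distr: "distr (samples UNIV) (samples ?J) (\<lambda>x. restrict x ?J) = samples ?J"
      by (rule distr_PiM_reindex) (auto intro: prob_space_axioms)
    have meas[measurable]: "(\<lambda>x. restrict x ?J) \<in> samples UNIV \<rightarrow>\<^sub>M samples ?J"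
      by (rule measurable_restrict_subset) simp
    have comp: "(\<lambda>x. x k \<bullet> u) \<in> borel_measurable (samples ?J)" if "k \<in> ?J" for k
      using measurable_component_borel[OF that] by (intro borel_measurable_inner) auto
    have pred: "Measurable.pred (samples ?J) (\<lambda>x. x i \<bullet> u = x j \<bullet> u)"
      unfolding pred_def by (intro borel_measurable_eq comp) auto
    have "(\<integral>\<^sup>+x. indicator {x. x i \<bullet> u = x j \<bullet> u} x \<partial>samples ?J)
        = (\<integral>\<^sup>+x. \<integral>\<^sup>+z. indicator {x. x i \<bullet> u = x j \<bullet> u} (x(i := z)) \<partial>M \<partial>samples {j})"
      using ij pred by (intro P.product_nn_integral_insert) (auto simp: indicator_def)
    also have "\<dots> = (\<integral>\<^sup>+x. \<integral>\<^sup>+z. indicator {z. z \<bullet> u = x j \<bullet> u} z \<partial>M \<partial>samples {j})"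
      using ij by (intro nn_integral_cong) (auto simp: indicator_def)
    also have "\<dots> = 0"
    proof -
      have "{z. z \<bullet> u = t} \<in> sets M" for t
        unfolding sets_M by measurable
      then show ?thesis by (simp add: null u)
    qed
    finally have "(\<integral>\<^sup>+x. indicator {x. x i \<bullet> u = x j \<bullet> u} x \<partial>samples ?J) = 0" .
    then have "AE x in samples ?J. x i \<bullet> u \<noteq> x j \<bullet> u"
      using pred by (subst (asm) nn_integral_0_iff_AE) (auto simp: indicator_def elim: eventually_mono)
    then have "AE x in distr (samples UNIV) (samples ?J) (\<lambda>x. restrict x ?J). x i \<bullet> u \<noteq> x j \<bullet> u"
      unfolding distr .
    then have "AE x in samples UNIV. restrict x ?J i \<bullet> u \<noteq> restrict x ?J j \<bullet> u"
      by (rule AE_distrD[OF meas])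
    then show ?thesis by simp
  qed
  then have "AE x in samples UNIV. \<forall>u\<in>S. i \<noteq> j \<longrightarrow> x i \<bullet> u \<noteq> x j \<bullet> u" for i j
    by (cases "i = j") (auto intro: AE_finite_allI[OF finite_S])
  then show ?thesis
    by (intro AE_all_countable[THEN iffD2] allI)
qed

section \<open>Mean squared error in terms of the extreme points\<close>

lemma model_mean_count_le:
  assumes m: "0 \<le> m"
  shows "model_mean m (\<lambda>n j v. of_nat j) \<le> ennreal m"
proof -
  have "model_mean m (\<lambda>n j v. of_nat j) \<le> model_mean m (\<lambda>n j v. of_nat n)"
    by (intro model_mean_mono) (simp add: of_nat_mono)
  then show ?thesis
    by (simp add: model_mean_count poisson_mean_of_nat m)
qed

section \<open>Samples with a small hull\<close>

lemma nn_integral_missed_region: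
  assumes R: "R \<in> sets M"
  shows "(\<integral>\<^sup>+x. indicator {x. \<forall>l<n. x l \<notin> R} x \<partial>samples UNIV) = ennreal ((1 - prob R) ^ n)"
proof -
  have *: "{x \<in> space (samples UNIV). \<forall>l\<in>{..<n}. x l \<in> space M - R} \<in> sets (samples UNIV)"
    using R by measurable
  have "(\<integral>\<^sup>+x. indicator {x. \<forall>l<n. x l \<notin> R} x \<partial>samples UNIV)
      = (\<integral>\<^sup>+x. indicator {x \<in> space (samples UNIV). \<forall>l\<in>{..<n}. x l \<in> space M - R} x \<partial>samples UNIV)"
    by (intro nn_integral_cong) (auto simp: indicator_def space_PiM)
  also have "\<dots> = emeasure (samples UNIV) {x \<in> space (samples UNIV). \<forall>l\<in>{..<n}. x l \<in> space M - R}"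
    by (rule nn_integral_indicator[OF *])
  also have "\<dots> = (\<Prod>l<n. emeasure M (space M - R))"
    using R by (intro P.emeasure_PiM_Collect) auto
  also have "\<dots> = ennreal ((1 - prob R) ^ n)"
    using R by (simp add: emeasure_eq_measure prob_compl ennreal_power)
  finally show ?thesis .
qed

text \<open>If the hull is small, one of the regions contains no sample point.\<close>

lemma model_mean_small_hull_le:
  assumes m: "0 \<le> m" and q: "0 \<le> q" "q \<le> 1" and I: "finite I"
    and R: "\<And>i. i \<in> I \<Longrightarrow> R i \<in> sets M" "\<And>i. i \<in> I \<Longrightarrow> q \<le> prob (R i)"
    and hit: "\<And>n x. (\<And>i. i \<in> I \<Longrightarrow> \<exists>l<n. x l \<in> R i) \<Longrightarrow> \<kappa> \<le> hull_mass {..<n} x"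
  shows "model_mean m (\<lambda>n j v. g n * indicator {..<\<kappa>} v)
    \<le> of_nat (card I) * (ennreal (exp (- (m * q))) * poisson_mean (m * (1 - q)) g)"
proof -
  have "(\<integral>\<^sup>+x. g n * indicator {..<\<kappa>} (hull_mass {..<n} x) \<partial>samples UNIV)
      \<le> of_nat (card I) * (ennreal ((1 - q) ^ n) * g n)" for n
  proof -
    have meas: "(\<lambda>x. indicator {x. \<forall>l<n. x l \<notin> R i} x :: ennreal) \<in> borel_measurable (samples UNIV)" if "i \<in> I" for i
    proof -
      note [measurable] = R(1)[OF that]
      have "(\<lambda>x. (if \<forall>l\<in>{..<n}. x l \<notin> R i then 1 else 0) :: ennreal) \<in> borel_measurable (samples UNIV)"
        by measurable
      then show ?thesis
        by (simp only: indicator_def of_bool_def mem_Collect_eq lessThan_iff Ball_def)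
    qed
    have "g n * indicator {..<\<kappa>} (hull_mass {..<n} x) \<le> (\<Sum>i\<in>I. g n * indicator {x. \<forall>l<n. x l \<notin> R i} x)" for x
    proof (cases "hull_mass {..<n} x < \<kappa>")
      case True
      then obtain i where i: "i \<in> I" "\<forall>l<n. x l \<notin> R i"
        using hit[of n x] by (meson not_le)
      have "g n * indicator {..<\<kappa>} (hull_mass {..<n} x) = g n * indicator {x. \<forall>l<n. x l \<notin> R i} x"
        using True i by simp
      also have "\<dots> \<le> (\<Sum>i\<in>I. g n * indicator {x. \<forall>l<n. x l \<notin> R i} x)"
        using I i(1) by (intro member_le_sum) auto
      finally show ?thesis .
    qed simp
    then have "(\<integral>\<^sup>+x. g n * indicator {..<\<kappa>} (hull_mass {..<n} x) \<partial>samples UNIV)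
        \<le> (\<integral>\<^sup>+x. (\<Sum>i\<in>I. g n * indicator {x. \<forall>l<n. x l \<notin> R i} x) \<partial>samples UNIV)"
      by (intro nn_integral_mono)
    also have "\<dots> = (\<Sum>i\<in>I. \<integral>\<^sup>+x. g n * indicator {x. \<forall>l<n. x l \<notin> R i} x \<partial>samples UNIV)"
      by (rule nn_integral_sum) (rule borel_measurable_times_ennreal[OF borel_measurable_const meas])
    also have "\<dots> = (\<Sum>i\<in>I. g n * ennreal ((1 - prob (R i)) ^ n))"
    proof (rule sum.cong[OF refl])
      fix i assume i: "i \<in> I"
      show "(\<integral>\<^sup>+x. g n * indicator {x. \<forall>l<n. x l \<notin> R i} x \<partial>samples UNIV) = g n * ennreal ((1 - prob (R i)) ^ n)"
        unfolding nn_integral_missed_region[OF R(1)[OF i], symmetric]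
        by (rule nn_integral_cmult[OF meas[OF i]])
    qed
    also have "\<dots> \<le> (\<Sum>i\<in>I. g n * ennreal ((1 - q) ^ n))"
      using R(2) by (intro sum_mono mult_left_mono ennreal_leI power_mono) simp_all
    also have "\<dots> = of_nat (card I) * (ennreal ((1 - q) ^ n) * g n)"
      by (simp only: sum_constant mult.commute[of "g n"])
    finally show ?thesis .
  qed
  then have "model_mean m (\<lambda>n j v. g n * indicator {..<\<kappa>} v)
      \<le> poisson_mean m (\<lambda>n. of_nat (card I) * (ennreal ((1 - q) ^ n) * g n))"
    unfolding model_mean_def by (intro poisson_mean_mono)
  also have "\<dots> = of_nat (card I) * (ennreal (exp (- (m * q))) * poisson_mean (m * (1 - q)) g)"
    using poisson_mean_thinning[OF m, of "1 - q" g] q by (simp only: poisson_mean_cmult) simp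
  finally show ?thesis .
qed

section \<open>Risk terms for a law with regions that force a hull of mass at least \<kappa>\<close>

context
  fixes m \<kappa> :: real and R :: "'i \<Rightarrow> (real ^ 'd) set" and I :: "'i set"
  assumes m: "1 \<le> m" and kappa: "0 < \<kappa>" "\<kappa> \<le> 1" and I: "finite I"
    and R: "\<And>i. i \<in> I \<Longrightarrow> R i \<in> sets M" "\<And>i. i \<in> I \<Longrightarrow> \<kappa> \<le> prob (R i)"
    and hit: "\<And>n x. (\<And>i. i \<in> I \<Longrightarrow> \<exists>l<n. x l \<in> R i) \<Longrightarrow> \<kappa> \<le> hull_mass {..<n} x"
    and null: "\<And>u t. u \<in> S \<Longrightarrow> emeasure M {z. z \<bullet> u = t} = 0"
begin

lemma AE_card_extremes_le:
  "AE x in samples UNIV. \<forall>n. card (extremes S {..<n} x) \<le> card S"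
  using AE_no_ties[OF null] by (rule eventually_mono) (auto intro: card_extremes_le_directions)

lemma model_mean_extremes_le:
  "model_mean m (\<lambda>n j v. of_nat j) \<le> ennreal (min (real (card S)) m)"
proof -
  have "model_mean m (\<lambda>n j v. of_nat j) \<le> model_mean m (\<lambda>n j v. of_nat (card S))"
    using AE_card_extremes_le
    by (intro model_mean_mono_AE) (auto elim!: eventually_mono simp: of_nat_mono)
  also have "\<dots> = ennreal (real (card S))"
    using m by (simp add: model_mean_count poisson_mean_const ennreal_of_nat_eq_real_of_nat)
  finally show ?thesis
    using model_mean_count_le[of m] m by (simp add: min_def)
qed

text \<open>Almost surely \<open>j^2\<close> is at most \<open>card S * n\<close>, and always at
  most \<open>n^2\<close>; \<open>m \<ge> 1\<close> absorbs the linear term of the second Poisson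
  moment. The factor \<open>m\<close> of the bound is later cancelled by the conditional bound
  \<open>5 / (\<kappa> * m)\<close>.\<close>

lemma model_mean_extremes_square_le:
  "model_mean m (\<lambda>n j v. of_nat (j\<^sup>2)) \<le> ennreal (2 * m * min (real (card S)) m)"
proof -
  have "model_mean m (\<lambda>n j v. of_nat (j\<^sup>2)) \<le> model_mean m (\<lambda>n j v. of_nat (card S) * of_nat n)"
  proof (rule model_mean_mono_AE, use AE_card_extremes_le in eventually_elim)
    case (elim x)
    have "(card (extremes S {..<n} x))\<^sup>2 \<le> card S * n" for n
      using elim card_extremes_le[of n x] by (auto simp: power2_eq_square intro: mult_mono)
    from of_nat_mono[OF this, where 'a = ennreal] show ?case
      by (intro allI) (simp only: of_nat_mult)
  qed
  also have "\<dots> = ennreal (real (card S) * m)"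
    unfolding model_mean_count using m
    by (simp add: poisson_mean_cmult poisson_mean_of_nat ennreal_mult) (simp add: ennreal_of_nat_eq_real_of_nat)
  also have "\<dots> \<le> ennreal (2 * m * real (card S))"
    using m by (intro ennreal_leI) (simp add: mult.commute)
  finally have 1: "model_mean m (\<lambda>n j v. of_nat (j\<^sup>2)) \<le> ennreal (2 * m * real (card S))" .
  have "model_mean m (\<lambda>n j v. of_nat (j\<^sup>2)) \<le> model_mean m (\<lambda>n j v. of_nat (n\<^sup>2))"
    by (intro model_mean_mono of_nat_mono power_mono) auto
  also have "\<dots> = ennreal (m\<^sup>2 + m)"
    using m by (simp add: model_mean_count poisson_mean_of_nat_power2 del: of_nat_power)
  also have "\<dots> \<le> ennreal (2 * m * m)"
    using m mult_right_mono[of 1 m m] by (intro ennreal_leI) (simp add: power2_eq_square)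
  finally show ?thesis
    using 1 by (simp add: min_def)
qed

text \<open>The same two bounds on \<open>j^2\<close>, now with the factor
  \<open>exp (- (m * \<kappa>))\<close> from a missed region. It compensates one factor
  \<open>m\<close>, since \<open>m * exp (- (m * \<kappa>)) \<le> 1 / \<kappa>\<close>.\<close>

lemma model_mean_extremes_square_small_hull_le:
  "model_mean m (\<lambda>n j v. of_nat (j\<^sup>2) * indicator {..<\<kappa>} v)
    \<le> ennreal (2 * real (card I) / \<kappa> * min (real (card S)) m)"
proof -
  have e: "exp (- (m * \<kappa>)) * m \<le> 1 / \<kappa>"
  proof -
    have "m * \<kappa> \<le> exp (m * \<kappa>)"
      using exp_ge_add_one_self[of "m * \<kappa>"] by linarith
    then have "exp (- (m * \<kappa>)) * (m * \<kappa>) \<le> exp (- (m * \<kappa>)) * exp (m * \<kappa>)"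
      by (intro mult_left_mono) auto
    also have "\<dots> = 1"
      by (simp add: exp_minus)
    finally have "exp (- (m * \<kappa>)) * m * \<kappa> \<le> 1"
      by (simp only: mult.assoc)
    then show ?thesis
      using kappa by (simp only: le_divide_eq_1_pos pos_le_divide_eq)
  qed
  have mk: "0 \<le> m * (1 - \<kappa>)" "m * (1 - \<kappa>) \<le> m"
    using m kappa mult_left_mono[of "1 - \<kappa>" 1 m] by auto
  have "model_mean m (\<lambda>n j v. of_nat (j\<^sup>2) * indicator {..<\<kappa>} v)
      \<le> model_mean m (\<lambda>n j v. (of_nat (card S) * of_nat n) * indicator {..<\<kappa>} v)"
  proof (rule model_mean_mono_AE, use AE_card_extremes_le in eventually_elim)
    case (elim x)
    have "(card (extremes S {..<n} x))\<^sup>2 \<le> card S * n" for n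
      using elim card_extremes_le[of n x] by (auto simp: power2_eq_square intro: mult_mono)
    from of_nat_mono[OF this, where 'a = ennreal] show ?case
      by (intro allI mult_right_mono) (simp_all only: of_nat_mult zero_le)
  qed
  also have "\<dots> \<le> of_nat (card I) * (ennreal (exp (- (m * \<kappa>)))
      * poisson_mean (m * (1 - \<kappa>)) (\<lambda>n. of_nat (card S) * of_nat n))"
    using m kappa by (intro model_mean_small_hull_le[where R = R and I = I] I R hit) auto
  also have "\<dots> = ennreal (real (card I) * (exp (- (m * \<kappa>)) * (real (card S) * (m * (1 - \<kappa>)))))"
    using mk by (simp add: poisson_mean_cmult poisson_mean_of_nat ennreal_mult del: right_diff_distrib)
      (simp add: ennreal_of_nat_eq_real_of_nat)
  also have "\<dots> \<le> ennreal (2 * real (card I) / \<kappa> * real (card S))"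
  proof (intro ennreal_leI)
    have "real (card I) * (exp (- (m * \<kappa>)) * (real (card S) * (m * (1 - \<kappa>))))
        \<le> real (card I) * (exp (- (m * \<kappa>)) * (real (card S) * m))"
      using mk by (intro mult_left_mono) auto
    also have "\<dots> = real (card I) * real (card S) * (exp (- (m * \<kappa>)) * m)" by simp
    also have "\<dots> \<le> real (card I) * real (card S) * (2 / \<kappa>)"
      using kappa by (intro mult_left_mono order_trans[OF e] divide_right_mono) auto
    finally show "real (card I) * (exp (- (m * \<kappa>)) * (real (card S) * (m * (1 - \<kappa>))))
        \<le> 2 * real (card I) / \<kappa> * real (card S)" by (simp add: mult_ac)
  qed
  finally have 1: "model_mean m (\<lambda>n j v. of_nat (j\<^sup>2) * indicator {..<\<kappa>} v)
      \<le> ennreal (2 * real (card I) / \<kappa> * real (card S))" .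
  have "model_mean m (\<lambda>n j v. of_nat (j\<^sup>2) * indicator {..<\<kappa>} v)
      \<le> model_mean m (\<lambda>n j v. of_nat (n\<^sup>2) * indicator {..<\<kappa>} v)"
    by (intro model_mean_mono mult_right_mono of_nat_mono power_mono) auto
  also have "\<dots> \<le> of_nat (card I) * (ennreal (exp (- (m * \<kappa>))) * poisson_mean (m * (1 - \<kappa>)) (\<lambda>n. of_nat (n\<^sup>2)))"
    using m kappa by (intro model_mean_small_hull_le[where R = R and I = I] I R hit) auto
  also have "\<dots> = ennreal (real (card I) * (exp (- (m * \<kappa>)) * ((m * (1 - \<kappa>))\<^sup>2 + m * (1 - \<kappa>))))"
    using mk by (simp add: poisson_mean_of_nat_power2 ennreal_mult del: of_nat_power)
      (simp add: ennreal_of_nat_eq_real_of_nat)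
  also have "\<dots> \<le> ennreal (2 * real (card I) / \<kappa> * m)"
  proof (intro ennreal_leI)
    have "(m * (1 - \<kappa>))\<^sup>2 + m * (1 - \<kappa>) \<le> m\<^sup>2 + m * m"
    proof (intro add_mono power_mono mk)
      have "m \<le> m * m"
        using m mult_left_mono[of 1 m m] by simp
      then show "m * (1 - \<kappa>) \<le> m * m"
        using mk(2) by (rule order_trans[rotated])
    qed
    then have "real (card I) * (exp (- (m * \<kappa>)) * ((m * (1 - \<kappa>))\<^sup>2 + m * (1 - \<kappa>)))
        \<le> real (card I) * (exp (- (m * \<kappa>)) * (m\<^sup>2 + m * m))"
      by (intro mult_left_mono) auto
    also have "\<dots> = 2 * real (card I) * m * (exp (- (m * \<kappa>)) * m)"
      by (simp add: power2_eq_square)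
    also have "\<dots> \<le> 2 * real (card I) * m * (1 / \<kappa>)"
      using m by (intro mult_left_mono e) auto
    finally show "real (card I) * (exp (- (m * \<kappa>)) * ((m * (1 - \<kappa>))\<^sup>2 + m * (1 - \<kappa>)))
        \<le> 2 * real (card I) / \<kappa> * m" by (simp add: mult_ac)
  qed
  finally show ?thesis
    using 1 by (simp add: min_def)
qed

text \<open>Given the hull, \<open>n - j\<close> is Poisson with mean \<open>m * v\<close>, so the
  bracket is the ratio of \<open>poisson_mean_ratio_le\<close>. In the constant,
  \<open>10 / \<kappa>\<close> is \<open>5 / (\<kappa> * m)\<close> times the \<open>2 * m\<close>
  of the second moment of \<open>j\<close>; the other part is 5 times the bound for small
  hulls.\<close>

lemma model_mean_ratio_error_le:
  "model_mean m (\<lambda>n j v. ennreal ((real j * (m * v / (real (n - j) + 1) - 1))\<^sup>2))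
    \<le> ennreal ((10 / \<kappa> + 10 * real (card I) / \<kappa>) * min (real (card S)) m)"
proof -
  define k where "k = min (real (card S)) m"
  have k: "0 \<le> k" using m by (simp add: k_def)
  have "model_mean m (\<lambda>n j v. ennreal ((real j * (m * v / (real (n - j) + 1) - 1))\<^sup>2))
      = model_mean m (\<lambda>n j v. poisson_mean (m * v)
          (\<lambda>l. ennreal ((real j * (m * v / (real (j + l - j) + 1) - 1))\<^sup>2)))"
    using m by (intro model_mean_condition) auto
  also have "\<dots> \<le> model_mean m (\<lambda>n j v. ennreal (5 / (\<kappa> * m)) * of_nat (j\<^sup>2)
      + 5 * (of_nat (j\<^sup>2) * indicator {..<\<kappa>} v))"
  proof (intro model_mean_mono)
    fix j and v :: real assume v: "0 \<le> v"
    have mv: "0 \<le> m * v" using m v by simp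
    have "poisson_mean (m * v) (\<lambda>l. ennreal ((real j * (m * v / (real (j + l - j) + 1) - 1))\<^sup>2))
        = of_nat (j\<^sup>2) * poisson_mean (m * v) (\<lambda>l. ennreal ((m * v / (real l + 1) - 1)\<^sup>2))"
      by (simp add: power_mult_distrib ennreal_mult poisson_mean_cmult
          ennreal_of_nat_eq_real_of_nat del: of_nat_power) (simp add: ennreal_of_nat_eq_real_of_nat)
    also have "\<dots> \<le> of_nat (j\<^sup>2) * (ennreal (5 / (\<kappa> * m)) + 5 * indicator {..<\<kappa>} v)"
    proof (intro mult_left_mono)
      show "poisson_mean (m * v) (\<lambda>l. ennreal ((m * v / (real l + 1) - 1)\<^sup>2))
        \<le> ennreal (5 / (\<kappa> * m)) + 5 * indicator {..<\<kappa>} v"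
      proof (cases "v < \<kappa>")
        case True
        \<comment> \<open>A bound free of \<open>v\<close>: 1 if \<open>m * v \<le> 1\<close>, and
          \<open>5 / (m * v) \<le> 5\<close> otherwise.\<close>
        have "poisson_mean (m * v) (\<lambda>l. ennreal ((m * v / (real l + 1) - 1)\<^sup>2)) \<le> 5"
        proof (cases "m * v \<le> 1")
          case True
          then show ?thesis
            using order_trans[OF poisson_mean_ratio_le_one[OF mv True], of 5] by simp
        next
          case False
          have "poisson_mean (m * v) (\<lambda>l. ennreal ((m * v / (real l + 1) - 1)\<^sup>2)) \<le> ennreal (5 / (m * v))"
            using False by (intro poisson_mean_ratio_le) auto
          also have "\<dots> \<le> ennreal 5"
            using False by (intro ennreal_leI) (auto simp: divide_le_eq)
          finally show ?thesis by simp
        qed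
        also have "5 \<le> ennreal (5 / (\<kappa> * m)) + 5 * indicator {..<\<kappa>} v"
          using True by (simp add: add_increasing)
        finally show ?thesis .
      next
        case False
        then have "\<kappa> * m \<le> m * v" "0 < \<kappa> * m"
          using m kappa by (auto simp: mult.commute)
        then have "poisson_mean (m * v) (\<lambda>l. ennreal ((m * v / (real l + 1) - 1)\<^sup>2)) \<le> ennreal (5 / (m * v))"
          by (intro poisson_mean_ratio_le) auto
        also have "\<dots> \<le> ennreal (5 / (\<kappa> * m))"
          using \<open>\<kappa> * m \<le> m * v\<close> \<open>0 < \<kappa> * m\<close> by (intro ennreal_leI divide_left_mono) auto
        finally show ?thesis
          using False by simp
      qed
    qed simp
    finally show "poisson_mean (m * v) (\<lambda>l. ennreal ((real j * (m * v / (real (j + l - j) + 1) - 1))\<^sup>2))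
        \<le> ennreal (5 / (\<kappa> * m)) * of_nat (j\<^sup>2) + 5 * (of_nat (j\<^sup>2) * indicator {..<\<kappa>} v)"
      by (simp only: distrib_left mult.commute mult.left_commute)
  qed
  also have "\<dots> = ennreal (5 / (\<kappa> * m)) * model_mean m (\<lambda>n j v. of_nat (j\<^sup>2))
      + 5 * model_mean m (\<lambda>n j v. of_nat (j\<^sup>2) * indicator {..<\<kappa>} v)"
  proof -
    have "model_mean m (\<lambda>n j v. ennreal (5 / (\<kappa> * m)) * of_nat (j\<^sup>2))
        = ennreal (5 / (\<kappa> * m)) * model_mean m (\<lambda>n j v. of_nat (j\<^sup>2))"
      by (rule model_mean_cmult) simp
    moreover have "model_mean m (\<lambda>n j v. 5 * (of_nat (j\<^sup>2) * indicator {..<\<kappa>} v))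
        = 5 * model_mean m (\<lambda>n j v. of_nat (j\<^sup>2) * indicator {..<\<kappa>} v)"
      by (rule model_mean_cmult) measurable
    moreover have "model_mean m (\<lambda>n j v. ennreal (5 / (\<kappa> * m)) * of_nat (j\<^sup>2)
          + 5 * (of_nat (j\<^sup>2) * indicator {..<\<kappa>} v))
        = model_mean m (\<lambda>n j v. ennreal (5 / (\<kappa> * m)) * of_nat (j\<^sup>2))
          + model_mean m (\<lambda>n j v. 5 * (of_nat (j\<^sup>2) * indicator {..<\<kappa>} v))"
      by (rule model_mean_add) measurable
    ultimately show ?thesis by (simp only:)
  qed
  also have "\<dots> \<le> ennreal (5 / (\<kappa> * m)) * ennreal (2 * m * k)
      + 5 * ennreal (2 * real (card I) / \<kappa> * k)"
    by (intro add_mono mult_left_mono model_mean_extremes_square_le[folded k_def]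
        model_mean_extremes_square_small_hull_le[folded k_def]) auto
  also have "\<dots> = ennreal (5 / (\<kappa> * m)) * ennreal (2 * m * k)
      + ennreal 5 * ennreal (2 * real (card I) / \<kappa> * k)"
    by simp
  also have "\<dots> = ennreal (5 / (\<kappa> * m) * (2 * m * k) + 5 * (2 * real (card I) / \<kappa> * k))"
    using m kappa k by (subst (1 2) ennreal_mult[symmetric]) (auto simp: ennreal_plus)
  also have "5 / (\<kappa> * m) * (2 * m * k) + 5 * (2 * real (card I) / \<kappa> * k)
      = (10 / \<kappa> + 10 * real (card I) / \<kappa>) * k"
    using m kappa by (simp add: distrib_right)
  finally show ?thesis
    unfolding k_def .
qed

text \<open>The integrand is what bounds the squared error scaled by \<lambda> squared; its factors
  2 come from \<open>(a + b)^2 \<le> 2 * a^2 + 2 * b^2\<close>.\<close>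

lemma model_mean_risk_le:
  "model_mean m (\<lambda>n j v. ennreal (2 * (real j + m * v - m)\<^sup>2
      + 2 * (real j * (m * v / (real (n - j) + 1) - 1))\<^sup>2))
    \<le> ennreal ((2 + 20 / \<kappa> + 20 * real (card I) / \<kappa>) * min (real (card S)) m)"
proof -
  define k where "k = min (real (card S)) m"
  have k: "0 \<le> k" using m by (simp add: k_def)
  have "model_mean m (\<lambda>n j v. ennreal (2 * (real j + m * v - m)\<^sup>2
      + 2 * (real j * (m * v / (real (n - j) + 1) - 1))\<^sup>2))
    = model_mean m (\<lambda>n j v. 2 * ennreal ((real j + m * v - m)\<^sup>2)
      + 2 * ennreal ((real j * (m * v / (real (n - j) + 1) - 1))\<^sup>2))"
    by (intro model_mean_cong) (simp add: ennreal_plus ennreal_mult')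
  also have "\<dots> = 2 * model_mean m (\<lambda>n j v. ennreal ((real j + m * v - m)\<^sup>2))
      + 2 * model_mean m (\<lambda>n j v. ennreal ((real j * (m * v / (real (n - j) + 1) - 1))\<^sup>2))"
    by (subst model_mean_add) (auto simp: model_mean_cmult)
  also have "\<dots> = 2 * model_mean m (\<lambda>n j v. of_nat j)
      + 2 * model_mean m (\<lambda>n j v. ennreal ((real j * (m * v / (real (n - j) + 1) - 1))\<^sup>2))"
    using m by (simp only: model_mean_score_square)
  also have "\<dots> \<le> 2 * ennreal k + 2 * ennreal ((10 / \<kappa> + 10 * real (card I) / \<kappa>) * k)"
    by (intro add_mono mult_left_mono model_mean_extremes_le[folded k_def] model_mean_ratio_error_le[folded k_def]) auto
  also have "\<dots> = ennreal 2 * ennreal k + ennreal 2 * ennreal ((10 / \<kappa> + 10 * real (card I) / \<kappa>) * k)"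
    by simp
  also have "\<dots> = ennreal (2 * k + 2 * ((10 / \<kappa> + 10 * real (card I) / \<kappa>) * k))"
    using m kappa k by (subst (1 2) ennreal_mult[symmetric]) (auto simp: ennreal_plus)
  also have "2 * k + 2 * ((10 / \<kappa> + 10 * real (card I) / \<kappa>) * k)
      = (2 + 20 / \<kappa> + 20 * real (card I) / \<kappa>) * k"
    by (simp add: algebra_simps)
  finally show ?thesis
    unfolding k_def .
qed

end

end

section \<open>Regions that force a large hull\<close>

text \<open>The rows of a matrix encode \<open>CARD('d)\<close> points of \<open>K\<close>, and the
  modulus of its determinant is the volume they span with the origin. Matrices with rows in
  \<open>K\<close> form a compact set.\<close>

lemma ex_max_abs_det:
  fixes K :: "(real ^ 'd) set"
  assumes "compact K" "K \<noteq> {}"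
  obtains A :: "real ^ 'd ^ 'd" where "\<And>i. A $ i \<in> K"
    "\<And>B. (\<And>i. B $ i \<in> K) \<Longrightarrow> \<bar>det B\<bar> \<le> \<bar>det A\<bar>"
proof -
  let ?T = "{A :: real ^ 'd ^ 'd. \<forall>i. A $ i \<in> K}"
  have "closed ?T"
  proof -
    have "?T = (\<Inter>i. (\<lambda>A. A $ i) -` K)" by auto
    moreover have "closed ((\<lambda>A :: real ^ 'd ^ 'd. A $ i) -` K)" for i
      using assms(1) by (intro closed_vimage compact_imp_closed continuous_intros) auto
    ultimately show ?thesis by auto
  qed
  moreover have "bounded ?T"
  proof -
    obtain b where b: "\<And>x. x \<in> K \<Longrightarrow> norm x \<le> b"
      using compact_imp_bounded[OF assms(1)] by (auto simp: bounded_iff)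
    have "norm A \<le> real CARD('d) * b" if "A \<in> ?T" for A
    proof -
      have "norm A \<le> (\<Sum>i\<in>UNIV. norm (A $ i))"
        unfolding norm_vec_def[of A] by (rule L2_set_le_sum) auto
      also have "\<dots> \<le> (\<Sum>i\<in>(UNIV :: 'd set). b)"
        using that b by (intro sum_mono) auto
      finally show ?thesis by simp
    qed
    then show ?thesis by (auto simp: bounded_iff)
  qed
  ultimately have "compact ?T" by (simp add: compact_eq_bounded_closed)
  moreover obtain k where "k \<in> K" using assms(2) by auto
  then have "(\<chi> i. k) \<in> ?T" by simp
  then have "?T \<noteq> {}" by blast
  moreover have "continuous_on ?T (\<lambda>A. \<bar>det A\<bar>)"
    unfolding det_def by (intro continuous_intros)
  ultimately obtain A where "A \<in> ?T" "\<And>B. B \<in> ?T \<Longrightarrow> \<bar>det B\<bar> \<le> \<bar>det A\<bar>"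
    using continuous_attains_sup[of ?T "\<lambda>A. \<bar>det A\<bar>"] by auto
  then show ?thesis
    by (intro that[of A]) auto
qed

text \<open>The coordinate \<open>c $ k\<close> is a quotient of determinants, the numerator being
  that of \<open>A\<close> with row \<open>k\<close> replaced by \<open>y\<close>. As
  \<open>y\<close> lies in \<open>K\<close>, this matrix competes in the maximum.\<close>

lemma coordinates_wrt_max_det:
  fixes A :: "real ^ 'd ^ 'd"
  assumes A: "\<And>i. A $ i \<in> K" and max: "\<And>B. (\<And>i. B $ i \<in> K) \<Longrightarrow> \<bar>det B\<bar> \<le> \<bar>det A\<bar>"
    and nz: "det A \<noteq> 0" and y: "y \<in> K"
  obtains c :: "real ^ 'd" where "y = (\<Sum>i\<in>UNIV. c $ i *\<^sub>R A $ i)" "\<And>i. \<bar>c $ i\<bar> \<le> 1"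
proof -
  have "invertible (transpose A)"
    using nz by (simp add: invertible_det_nz)
  then obtain B where B: "transpose A ** B = mat 1"
    unfolding invertible_def by auto
  define c where "c = B *v y"
  have "y = transpose A *v c"
    by (simp add: c_def matrix_vector_mul_assoc B)
  then have yc: "y = (\<Sum>i\<in>UNIV. c $ i *s row i A)"
    by (simp add: matrix_mult_sum)
  have "\<bar>c $ k\<bar> \<le> 1" for k
  proof -
    have "\<bar>c $ k * det A\<bar> \<le> \<bar>det A\<bar>"
      unfolding cramer_lemma_transpose[of k c A, symmetric] yc[symmetric]
      using A y by (intro max) (auto simp: row_def vec_lambda_eta)
    then show ?thesis
      using nz by (simp add: abs_mult)
  qed
  moreover have "y = (\<Sum>i\<in>UNIV. c $ i *\<^sub>R A $ i)"
    unfolding yc by (intro sum.cong) (auto simp: row_def vec_lambda_eta scalar_mult_eq_scaleR)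
  ultimately show ?thesis by (intro that) auto
qed

text \<open>In coordinates: a box around the centre of the standard simplex lies in the hull of points
  chosen from boxes near its vertices.\<close>

lemma simplex_boxes_dominate:
  fixes w :: "'d::finite \<Rightarrow> real" and y :: "'d option \<Rightarrow> 'd \<Rightarrow> real"
  defines "d \<equiv> real CARD('d)"
  assumes y0: "\<And>i j. 0 \<le> y i j"
    and y1: "\<And>i j. i \<noteq> Some j \<Longrightarrow> y i j \<le> 1 / (4 * d)"
    and y2: "\<And>j. 3 / 4 \<le> y (Some j) j"
    and z: "\<And>j. 1 / (4 * d) \<le> z j" "\<And>j. z j \<le> 3 / (4 * d)"
  shows "\<exists>i. (\<Sum>j\<in>UNIV. z j * w j) \<le> (\<Sum>j\<in>UNIV. y i j * w j)"
proof -
  have d: "1 \<le> d"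
    by (simp add: d_def Suc_le_eq)
  \<comment> \<open>Positive and negative parts of the functional. The bounds on the coordinates of
    \<open>z\<close> limit its value to \<open>3 / (4 * d) * p - 1 / (4 * d) * q\<close>.\<close>
  define p where "p = (\<Sum>j\<in>UNIV. max (w j) 0)"
  define q where "q = (\<Sum>j\<in>UNIV. max (- w j) 0)"
  have "(\<Sum>j\<in>UNIV. z j * w j) \<le> (\<Sum>j\<in>UNIV. 3 / (4 * d) * max (w j) 0 - 1 / (4 * d) * max (- w j) 0)"
  proof (intro sum_mono)
    fix j
    show "z j * w j \<le> 3 / (4 * d) * max (w j) 0 - 1 / (4 * d) * max (- w j) 0"
    proof (cases "0 \<le> w j")
      case True
      then show ?thesis using mult_right_mono[OF z(2) True] by simp
    next
      case False
      then show ?thesis using mult_right_mono_neg[OF z(1), of "w j" j] by simp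
    qed
  qed
  then have zw: "(\<Sum>j\<in>UNIV. z j * w j) \<le> 3 / (4 * d) * p - 1 / (4 * d) * q"
    by (simp add: p_def q_def sum_subtractf sum_distrib_left)
  show ?thesis
  \<comment> \<open>If no coefficient is positive, the box at the origin dominates. Otherwise the
    box of the largest coefficient \<open>w k\<close> does: as \<open>p \<le> d * w k\<close>, its
    gain of at least \<open>3 / 4 * w k\<close> covers \<open>3 / (4 * d) * p\<close>, and its other
    coordinates lose at most \<open>1 / (4 * d) * q\<close>.\<close>
  proof (cases "\<forall>j. w j \<le> 0")
    case True
    then have "p = 0" by (simp add: p_def max_def)
    have "- (1 / (4 * d)) * q = (\<Sum>j\<in>UNIV. 1 / (4 * d) * w j)"
    proof -
      have "max (- w j) 0 = - w j" for j
        using True by (simp add: max_absorb1)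
      then show ?thesis
        by (simp add: q_def sum_distrib_left sum_negf)
    qed
    also have "\<dots> \<le> (\<Sum>j\<in>UNIV. y None j * w j)"
      using True y1[of None] by (intro sum_mono mult_right_mono_neg) auto
    finally show ?thesis
      using zw \<open>p = 0\<close> by (intro exI[of _ None]) simp
  next
    case False
    let ?m = "Max (range w)"
    have "?m \<in> range w" by (intro Max_in) auto
    then obtain k where k: "w k = ?m" by (metis imageE)
    have max: "w j \<le> w k" for j
      unfolding k by auto
    then have pos: "0 < w k"
      using False by (meson less_le_trans not_le)
    have "p \<le> (\<Sum>j\<in>(UNIV :: 'd set). w k)"
      unfolding p_def using max pos by (intro sum_mono) auto
    then have "p \<le> d * w k" by (simp add: d_def)
    then have "3 / (4 * d) * p \<le> 3 / (4 * d) * (d * w k)"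
      using d by (intro mult_left_mono) auto
    also have "\<dots> = 3 / 4 * w k" using d by simp
    finally have "(\<Sum>j\<in>UNIV. z j * w j) \<le> 3 / 4 * w k - 1 / (4 * d) * q"
      using zw by linarith
    also have "\<dots> \<le> (\<Sum>j\<in>UNIV. y (Some k) j * w j)"
    proof -
      have "(\<Sum>j\<in>UNIV. (if j = k then 3 / 4 * w k else 0) - 1 / (4 * d) * max (- w j) 0)
          \<le> (\<Sum>j\<in>UNIV. y (Some k) j * w j)"
      proof (intro sum_mono)
        fix j
        show "(if j = k then 3 / 4 * w k else 0) - 1 / (4 * d) * max (- w j) 0 \<le> y (Some k) j * w j"
        proof (cases "j = k")
          case True
          then show ?thesis using pos mult_right_mono[OF y2[of k], of "w k"] by simp
        next
          case jk: False
          show ?thesis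
          proof (cases "0 \<le> w j")
            case True
            then show ?thesis using jk y0 by simp
          next
            case False
            then show ?thesis
              using jk mult_right_mono_neg[OF y1[of "Some k" j], of "w j"] by simp
          qed
        qed
      qed
      then show ?thesis
        by (simp add: sum_subtractf sum_distrib_left q_def)
    qed
    finally show ?thesis by blast
  qed
qed

text \<open>With \<open>d = CARD('d)\<close>, the boxes have sides at least
  \<open>1 / (4 * d)\<close> in coordinates in which the convex set lies in a cube of side 2; this
  is the \<open>d\<close>-th power of the quotient of these sides.\<close>

definition box_ratio :: "'d itself \<Rightarrow> real" where
  "box_ratio _ = (1 / (8 * real CARD('d))) ^ CARD('d)"

lemma hitting_regions:
  fixes P :: "(real ^ 'd) set"
  assumes P: "compact P" "convex P" "0 < measure lborel P"
  obtains R :: "'d option \<Rightarrow> (real ^ 'd) set" and Z where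
    "\<And>i. compact (R i)" "\<And>i. R i \<subseteq> P" "\<And>i. box_ratio TYPE('d) * measure lborel P \<le> measure lborel (R i)"
    "compact Z" "Z \<subseteq> P" "box_ratio TYPE('d) * measure lborel P \<le> measure lborel Z"
    "\<And>y z w. (\<And>i. y i \<in> R i) \<Longrightarrow> z \<in> Z \<Longrightarrow> \<exists>i. z \<bullet> w \<le> y i \<bullet> w"
proof -
  let ?d = "real CARD('d)"
  have d: "1 \<le> ?d" by (simp add: Suc_le_eq)
  have "interior P \<noteq> {}"
  proof
    assume "interior P = {}"
    then have "measure lebesgue P = 0"
      using negligible_convex_interior[OF P(2)] by (auto intro: negligible_imp_measure0)
    moreover have "measure lebesgue P = measure lborel P"
      using P(1) by (simp add: measure_completion borel_compact)
    ultimately show False using P(3) by simp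
  qed
  then obtain x0 r where x0: "0 < r" "cball x0 r \<subseteq> P"
    using mem_interior_cball by blast
  define K where "K = (\<lambda>x. x - x0) ` P"
  have K: "compact K" "convex K" and K_iff: "y \<in> K \<longleftrightarrow> x0 + y \<in> P" for y
    using P by (auto simp: K_def intro!: compact_translation_subtract convex_translation_subtract image_eqI[of _ _ "x0 + y"])
  have K0: "0 \<in> K" and Kr: "r *\<^sub>R axis i 1 \<in> K" for i
    using x0 by (auto simp: K_iff dist_norm intro!: subsetD[OF x0(2)])
  obtain A where A: "\<And>i. A $ i \<in> K" and max: "\<And>B. (\<And>i. B $ i \<in> K) \<Longrightarrow> \<bar>det B\<bar> \<le> \<bar>det A\<bar>"
    using ex_max_abs_det[OF K(1)] K0 by blast
  \<comment> \<open>A multiple of the identity has its rows in \<open>K\<close>, because a ball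
    around \<open>x0\<close> lies in \<open>P\<close>; hence the maximal determinant is not
    0.\<close>
  have "det (mat r :: real ^ 'd ^ 'd) = r ^ CARD('d)"
    by (subst det_diagonal) (auto simp: mat_def)
  moreover have "\<bar>det (mat r :: real ^ 'd ^ 'd)\<bar> \<le> \<bar>det A\<bar>"
  proof (rule max)
    fix i
    have "(mat r :: real ^ 'd ^ 'd) $ i = r *\<^sub>R axis i 1"
      by (simp add: vec_eq_iff mat_def axis_def)
    then show "(mat r :: real ^ 'd ^ 'd) $ i \<in> K" using Kr by simp
  qed
  ultimately have nz: "det A \<noteq> 0"
    using zero_less_power[OF x0(1), of "CARD('d)"] by auto
  define L where "L c = (\<Sum>i\<in>UNIV. c $ i *\<^sub>R A $ i)" for c :: "real ^ 'd"
  have L_add: "L (a + b) = L a + L b" and L_scale: "L (s *\<^sub>R a) = s *\<^sub>R L a" for a b s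
    by (simp_all add: L_def scaleR_add_left sum.distrib scaleR_right.sum)
  have L_lin: "linear L"
    by (intro linearI L_add L_scale)
  define cube where "cube = L ` cbox 0 (\<chi> i. 1)"
  \<comment> \<open>The parallelepiped with corner \<open>a\<close> and side \<open>s\<close> in the
    coordinates \<open>c\<close> of \<open>x = x0 + L c\<close>. It is a scaled translate of
    \<open>cube\<close>, so volumes of cells compare by their sides alone, whatever the shape of
    \<open>P\<close>.\<close>
  define cell where "cell a s = (\<lambda>z. s *\<^sub>R z + (x0 + L a)) ` cube" for a s
  have cube: "compact cube"
    unfolding cube_def using L_lin
    by (intro compact_continuous_image linear_continuous_on) (auto simp: linear_conv_bounded_linear)
  have cell: "compact (cell a s)" for a s
    unfolding cell_def by (intro compact_continuous_image cube continuous_intros)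
  have cell_measure: "measure lborel (cell a s) = s ^ CARD('d) * measure lborel cube" if "0 \<le> s" for a s
  proof -
    have "measure lebesgue (cell a s) = s ^ CARD('d) * measure lebesgue cube"
      unfolding cell_def using measure_lebesgue_affine[of s "x0 + L a" cube] that by simp
    then show ?thesis
      using cell cube by (simp add: measure_completion borel_compact)
  qed
  have cell_iff: "x \<in> cell a s \<longleftrightarrow> (\<exists>c. x = x0 + L c \<and> (\<forall>i. a $ i \<le> c $ i \<and> c $ i \<le> a $ i + s))" if "0 < s" for x a s
  proof
    assume "x \<in> cell a s"
    then obtain b where "b \<in> cbox 0 (\<chi> i. 1)" and x: "x = s *\<^sub>R L b + (x0 + L a)"
      unfolding cell_def cube_def by blast
    then have b: "\<And>i. 0 \<le> b $ i" "\<And>i. b $ i \<le> 1"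
      by (auto simp: mem_box_cart)
    have "x = x0 + L (a + s *\<^sub>R b)"
      by (simp add: x L_add L_scale)
    moreover have "s * b $ i \<le> s * 1" "0 \<le> s * b $ i" for i
      using b that by (auto intro: mult_left_mono simp del: mult_1_right)
    ultimately show "\<exists>c. x = x0 + L c \<and> (\<forall>i. a $ i \<le> c $ i \<and> c $ i \<le> a $ i + s)"
      by (intro exI[of _ "a + s *\<^sub>R b"]) auto
  next
    assume "\<exists>c. x = x0 + L c \<and> (\<forall>i. a $ i \<le> c $ i \<and> c $ i \<le> a $ i + s)"
    then obtain c where c: "x = x0 + L c" "\<And>i. a $ i \<le> c $ i" "\<And>i. c $ i \<le> a $ i + s" by auto
    define b where "b = (1 / s) *\<^sub>R (c - a)"
    have "c = a + s *\<^sub>R b" using that by (simp add: b_def)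
    then have "x = s *\<^sub>R L b + (x0 + L a)"
      by (simp add: c(1) L_add L_scale)
    moreover have "b \<in> cbox 0 (\<chi> i. 1)"
    proof -
      have "0 \<le> c $ i - a $ i" "c $ i - a $ i \<le> s" for i
        using c(2,3)[of i] by simp_all
      then show ?thesis
        using that by (simp add: mem_box_cart b_def)
    qed
    ultimately show "x \<in> cell a s"
      by (auto simp: cell_def cube_def)
  qed
  have simplex: "x0 + L c \<in> P" if c: "\<And>i. 0 \<le> c $ i" "(\<Sum>i\<in>UNIV. c $ i) \<le> 1" for c
  proof -
    have "(\<Sum>i\<in>UNIV. c $ i *\<^sub>R A $ i) + (1 - (\<Sum>i\<in>UNIV. c $ i)) *\<^sub>R 0 \<in> K"
    proof -
      \<comment> \<open>The origin, indexed by \<open>None\<close>, takes the weight left over by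
        \<open>c\<close>.\<close>
      have "(\<Sum>i\<in>UNIV. (case i of None \<Rightarrow> 1 - (\<Sum>i\<in>UNIV. c $ i) | Some i \<Rightarrow> c $ i) *\<^sub>R (case i of None \<Rightarrow> 0 | Some i \<Rightarrow> A $ i)) \<in> K"
        using c K K0 A
        by (intro convex_sum) (auto simp: UNIV_option_conv sum.reindex split: option.split)
      then show ?thesis
        by (simp add: UNIV_option_conv sum.reindex)
    qed
    then show ?thesis by (simp add: L_def K_iff)
  qed
  have P_sub: "P \<subseteq> cell (\<chi> i. - 1) 2"
  proof
    fix x assume "x \<in> P"
    then have "x - x0 \<in> K" by (simp add: K_iff)
    then obtain c :: "real ^ 'd" where "x - x0 = L c" "\<And>i. \<bar>c $ i\<bar> \<le> 1"
      unfolding L_def using coordinates_wrt_max_det[OF A max nz] by blast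
    then show "x \<in> cell (\<chi> i. - 1) 2"
      by (subst cell_iff) (auto simp: abs_le_iff algebra_simps intro!: exI[of _ c])
  qed
  have "measure lborel P \<le> measure lborel (cell (\<chi> i. - 1) 2)"
    using P_sub cell P(1)
    by (intro measure_mono_fmeasurable) (auto simp: borel_compact fmeasurable_compact)
  then have P_le: "measure lborel P \<le> 2 ^ CARD('d) * measure lborel cube"
    by (simp add: cell_measure)
  have big: "box_ratio TYPE('d) * measure lborel P \<le> measure lborel (cell a s)" if "1 / (4 * ?d) \<le> s" for a s
  proof -
    have s: "0 \<le> s"
      by (rule order_trans[OF _ that]) simp
    have "box_ratio TYPE('d) * measure lborel P \<le> box_ratio TYPE('d) * (2 ^ CARD('d) * measure lborel cube)"
      using P_le by (intro mult_left_mono) (auto simp: box_ratio_def)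
    also have "\<dots> = (1 / (4 * ?d)) ^ CARD('d) * measure lborel cube"
      by (simp add: box_ratio_def power_mult_distrib[symmetric] power_divide[symmetric] mult.assoc[symmetric])
    also have "\<dots> \<le> s ^ CARD('d) * measure lborel cube"
      using that d by (intro mult_right_mono power_mono) auto
    finally show ?thesis by (simp add: cell_measure s)
  qed
  \<comment> \<open>With this side the coordinates in a box near a vertex sum to at most
    \<open>3 / 4 + d / (4 * d) = 1\<close>, so the box stays in the simplex. The coordinates in
    \<open>Z\<close> are at most \<open>3 / (4 * d)\<close>, with sum at most
    \<open>3 / 4\<close>.\<close>
  let ?e = "1 / (4 * ?d)"
  define R where "R i = cell (\<chi> j. if i = Some j then 3 / 4 else 0) ?e" for i
  define Z where "Z = cell (\<chi> i. ?e) (2 * ?e)"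
  have R_iff: "x \<in> R i \<longleftrightarrow> (\<exists>c. x = x0 + L c \<and>
      (\<forall>j. (if i = Some j then 3 / 4 else 0) \<le> c $ j \<and> c $ j \<le> (if i = Some j then 3 / 4 else 0) + ?e))" for x i
  proof -
    have "0 < ?e" using d by simp
    then show ?thesis
      unfolding R_def by (simp only: cell_iff vec_lambda_beta)
  qed
  have RP: "R i \<subseteq> P" for i
  proof
    fix x assume "x \<in> R i"
    then obtain c where c: "x = x0 + L c" "\<And>j. (if i = Some j then 3 / 4 else 0) \<le> c $ j"
        "\<And>j. c $ j \<le> (if i = Some j then 3 / 4 else 0) + ?e"
      unfolding R_iff by auto
    have "(\<Sum>j\<in>UNIV. c $ j) \<le> (\<Sum>j\<in>UNIV. (if i = Some j then 3 / 4 else 0) + ?e)"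
      by (intro sum_mono c)
    also have "\<dots> = (\<Sum>j\<in>UNIV. if i = Some j then 3 / 4 else 0) + 1 / 4"
      using d by (simp add: sum.distrib)
    also have "(\<Sum>j\<in>UNIV. if i = Some j then 3 / 4 else 0) \<le> (3 / 4 :: real)"
      by (cases i) auto
    finally have "(\<Sum>j\<in>UNIV. c $ j) \<le> 1" by simp
    moreover have "0 \<le> c $ j" for j
      using c(2)[of j] by (auto split: if_splits)
    ultimately show "x \<in> P"
      unfolding c(1) by (intro simplex)
  qed
  have dom: "\<exists>i. z \<bullet> w \<le> y i \<bullet> w" if y: "\<And>i. y i \<in> R i" and z: "z \<in> Z" for y z w
  proof -
    have "\<forall>i. \<exists>c. y i = x0 + L c \<and>
      (\<forall>j. (if i = Some j then 3 / 4 else 0) \<le> c $ j \<and> c $ j \<le> (if i = Some j then 3 / 4 else 0) + ?e)"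
      using y R_iff by simp
    then obtain c where c: "\<And>i. y i = x0 + L (c i)" "\<And>i j. (if i = Some j then 3 / 4 else 0) \<le> c i $ j"
      "\<And>i j. c i $ j \<le> (if i = Some j then 3 / 4 else 0) + ?e"
      by metis
    have "0 < 2 * ?e" using d by simp
    then obtain b where b: "z = x0 + L b" "\<And>j. ?e \<le> b $ j" "\<And>j. b $ j \<le> ?e + 2 * ?e"
      using z unfolding Z_def by (auto simp: cell_iff)
    have Lw: "(x0 + L a) \<bullet> w = x0 \<bullet> w + (\<Sum>j\<in>UNIV. a $ j * (A $ j \<bullet> w))" for a
      by (simp add: L_def inner_add_left inner_sum_left)
    have "\<exists>i. (\<Sum>j\<in>UNIV. b $ j * (A $ j \<bullet> w)) \<le> (\<Sum>j\<in>UNIV. c i $ j * (A $ j \<bullet> w))"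
    proof (rule simplex_boxes_dominate)
      fix i j
      show "0 \<le> c i $ j" using c(2)[of i j] by (auto split: if_splits)
      show "c i $ j \<le> ?e" if "i \<noteq> Some j" using c(3)[of i j] that by simp
      show "3 / 4 \<le> c (Some j) $ j" using c(2)[of "Some j" j] by simp
      show "?e \<le> b $ j" by (rule b)
      show "b $ j \<le> 3 / (4 * ?d)" using b(3)[of j] by simp
    qed
    then show ?thesis
      unfolding c(1) b(1) Lw by auto
  qed
  show ?thesis
  proof (rule that[of R Z])
    show "compact (R i)" for i by (simp add: R_def cell)
    show "box_ratio TYPE('d) * measure lborel P \<le> measure lborel (R i)" for i
      by (simp add: R_def big)
    show "compact Z" by (simp add: Z_def cell)
    show "Z \<subseteq> P"
    proof
      fix x assume "x \<in> Z"
      moreover have "0 < 2 * ?e" using d by simp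
      ultimately obtain b where b: "x = x0 + L b" "\<And>j. ?e \<le> b $ j" "\<And>j. b $ j \<le> ?e + 2 * ?e"
        unfolding Z_def by (auto simp: cell_iff)
      have "(\<Sum>j\<in>UNIV. b $ j) \<le> (\<Sum>j\<in>(UNIV :: 'd set). ?e + 2 * ?e)"
        by (intro sum_mono b)
      also have "\<dots> \<le> 1" using d by simp
      finally have "(\<Sum>j\<in>UNIV. b $ j) \<le> 1" .
      moreover have "0 \<le> b $ j" for j
        by (rule order_trans[OF _ b(2)]) simp
      ultimately show "x \<in> P"
        unfolding b(1) by (intro simplex)
    qed
    show "box_ratio TYPE('d) * measure lborel P \<le> measure lborel Z"
      unfolding Z_def by (intro big) (simp only: mult_2 le_add_same_cancel1, simp)
  qed (fact RP dom)+
qed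

section \<open>The Lambert function\<close>

text \<open>The intermediate value theorem on [0, z] gives existence. For positive \<open>z\<close>
  every solution is positive, and \<open>w * exp w\<close> is strictly increasing there.\<close>

lemma lambert_W_ex1:
  assumes "0 < z"
  shows "\<exists>!w. - 1 \<le> w \<and> w * exp w = (z :: real)"
proof -
  have "\<exists>w. 0 \<le> w \<and> w \<le> z \<and> w * exp w = z"
  proof (rule IVT')
    show "z \<le> z * exp z"
      using assms by simp
  qed (use assms in \<open>auto intro!: continuous_intros\<close>)
  then obtain w where w: "0 \<le> w" "w * exp w = z" by auto
  have "w' = w" if w': "- 1 \<le> w'" "w' * exp w' = z" for w'
  proof -
    have "0 < w'" "0 < w"
      using w w' assms by (smt (verit) exp_gt_zero mult_nonpos_nonneg)+
    moreover have "a * exp a < b * exp b" if "0 < a" "a < b" for a b :: real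
      using that by (intro mult_strict_mono) auto
    ultimately show ?thesis
      using w w' by (metis less_irrefl linorder_neqE_linordered_idom)
  qed
  then show ?thesis
    using w by (intro ex1I[of _ w]) auto
qed

lemma lambert_W:
  assumes "0 < z"
  shows "lambert_W z * exp (lambert_W z) = z" "0 < lambert_W z"
proof -
  show eq: "lambert_W z * exp (lambert_W z) = z"
    using theI'[OF lambert_W_ex1[OF assms]] unfolding lambert_W_def by simp
  show "0 < lambert_W z"
    using eq assms by (smt (verit) exp_gt_zero mult_nonpos_nonneg)
qed

text \<open>If \<open>2 * W < 1\<close> then \<open>exp W \<le> 2\<close>, hence
  \<open>z = W * exp W \<le> 2 * W\<close>. At \<open>z = lam / k\<close> the bound makes
  \<open>k * W z\<close> at least half of \<open>min k lam\<close>.\<close>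

lemma lambert_W_ge:
  assumes "0 < z"
  shows "min 1 z \<le> 2 * lambert_W z"
proof (rule ccontr)
  let ?w = "lambert_W z"
  assume "\<not> min 1 z \<le> 2 * ?w"
  then have w: "?w < 1 / 2" "?w < z / 2"
    by auto
  have "exp ?w \<le> 1 + ?w + ?w\<^sup>2"
    using w lambert_W(2)[OF assms] by (intro exp_bound) auto
  also have "\<dots> \<le> 2"
    using w lambert_W(2)[OF assms] mult_mono[of ?w "1 / 2" ?w "1 / 2"] by (simp add: power2_eq_square)
  finally have "?w * exp ?w \<le> ?w * 2"
    using lambert_W(2)[OF assms] by (intro mult_left_mono) auto
  then show False
    using w lambert_W(1)[OF assms] by simp
qed

text \<open>Here \<open>W\<close> is at least 1, so dropping it as a factor from
  \<open>W * exp W = z\<close> leaves \<open>exp W \<le> z\<close>.\<close>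

lemma lambert_W_le_ln:
  assumes "exp 1 \<le> z"
  shows "lambert_W z \<le> ln z"
proof -
  have z: "0 < z" using assms exp_gt_zero less_le_trans by blast
  let ?w = "lambert_W z"
  have "1 \<le> ?w"
  proof (rule ccontr)
    assume "\<not> 1 \<le> ?w"
    then have "?w * exp ?w < 1 * exp 1"
      using lambert_W(2)[OF z] by (intro mult_strict_mono) auto
    then show False using lambert_W(1)[OF z] assms by simp
  qed
  then have "1 * exp ?w \<le> ?w * exp ?w"
    by (intro mult_right_mono) auto
  then have "exp ?w \<le> z"
    using lambert_W(1)[OF z] by simp
  then show ?thesis
    using z by (simp add: ln_ge_iff)
qed

section \<open>The wrapping hull estimator\<close>

locale poisson_window =
  fixes S E P :: "(real ^ 'd) set" and lam :: real
  assumes window: "is_window S E" and P_class: "P \<in> polytope_class S E"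
    and lam: "0 < lam" and large: "1 \<le> lam * measure lborel P"
begin

lemma S_finite: "finite S" and S_zero: "0 \<notin> S"
  using window by (auto simp: is_window_def outer_facet_normals_def)

lemma P_sub: "P \<subseteq> E" and E_bounded: "bounded E" and E_compact: "compact E"
  using P_class window polytope_imp_bounded polytope_imp_compact
  by (auto simp: polytope_class_def is_window_def)

lemma P_pos: "0 < measure lborel P"
  using large lam by (smt (verit) mult_nonneg_nonpos)

lemma S_nonempty: "S \<noteq> {}"
proof
  assume "S = {}"
  then have "P = UNIV" using P_class by (auto simp: polytope_class_def)
  then show False
    using P_sub E_bounded bounded_subset not_bounded_UNIV by metis
qed

lemma P_compact: "compact P" and P_convex: "convex P"
proof -
  obtain h where h: "P = (\<Inter>u\<in>S. {x. x \<bullet> u \<le> h u})"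
    using P_class by (auto simp: polytope_class_def)
  show "convex P" unfolding h by (rule halfspaces_closed_convex)
  have "closed P" unfolding h by (rule halfspaces_closed_convex)
  then show "compact P"
    using bounded_subset[OF E_bounded P_sub] by (simp add: compact_eq_bounded_closed)
qed

lemma P_borel: "P \<in> sets lborel"
  using P_compact by (simp add: borel_compact)

lemma P_finite: "emeasure lborel P \<noteq> \<infinity>"
  using emeasure_compact_finite[OF P_compact] by auto

lemma P_emeasure: "emeasure lborel P = ennreal (measure lborel P)"
  using P_finite by (simp add: emeasure_eq_ennreal_measure)

lemma P_le_E: "measure lborel P \<le> measure lborel E"
  using P_compact E_compact P_sub
  by (intro measure_mono_fmeasurable) (auto simp: fmeasurable_compact borel_compact)

abbreviation "U \<equiv> uniform_measure lborel P"

lemma prob_space_U: "prob_space U"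
  using P_pos P_finite P_emeasure by (intro prob_space_uniform_measure) auto

sublocale iid_sample U S
proof -
  interpret prob_space U by (rule prob_space_U)
  show "iid_sample U S" by unfold_locales (simp_all add: S_finite)
qed

lemma measure_U: "B \<in> sets borel \<Longrightarrow> measure U B = measure lborel (P \<inter> B) / measure lborel P"
  using P_borel P_finite P_emeasure P_pos by (intro measure_uniform_measure) auto

lemma null_U:
  assumes "B \<in> null_sets lborel"
  shows "emeasure U B = 0"
proof -
  have "B \<in> sets lborel" and "P \<inter> B \<in> null_sets lborel"
    using assms null_set_Int1[OF assms P_borel] by (auto simp: Int_commute)
  then show ?thesis
    using emeasure_uniform_measure[OF P_borel, of B] by auto
qed

lemma weak_hull_borel: "finite A \<Longrightarrow> weak_hull S A \<in> sets borel"
proof (cases "A = {}")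
  case True
  then show ?thesis using S_nonempty by (simp add: weak_hull_def)
next
  case False
  assume "finite A"
  then show ?thesis
    unfolding weak_hull_eq_halfspaces[OF \<open>finite A\<close> False] by (intro borel_closed halfspaces_closed_convex)
qed

lemma prob_weak_hull:
  assumes "finite A"
  shows "prob (weak_hull S A) = prob (strict_hull S A)"
proof -
  have "weak_hull S A - strict_hull S A \<in> null_sets U"
    using null_weak_hull_minus_strict_hull[OF S_finite S_zero assms] null_U by (auto simp: null_sets_def)
  moreover have "strict_hull S A \<in> sets U" by (rule strict_hull_in_sets)
  ultimately have "measure U (strict_hull S A \<union> (weak_hull S A - strict_hull S A)) = measure U (strict_hull S A)"
    by (intro measure_Un_null_set)
  moreover have "strict_hull S A \<union> (weak_hull S A - strict_hull S A) = weak_hull S A"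
    using strict_hull_subset_weak_hull[of S A] by auto
  ultimately show ?thesis by simp
qed

lemma null_hyperplane:
  assumes "u \<in> S"
  shows "emeasure U {z. z \<bullet> u = t} = 0"
proof -
  have u: "u \<noteq> 0" using assms S_zero by auto
  then have "negligible {z. u \<bullet> z = t}"
    by (intro negligible_hyperplane) auto
  moreover have "{z. u \<bullet> z = t} \<in> sets borel"
    by (intro borel_closed closed_hyperplane)
  ultimately show ?thesis
    by (intro null_U) (simp add: negligible_iff_null_sets null_sets_completion_iff inner_commute)
qed

lemma model_mean_risk:
  "model_mean (lam * measure lborel P) (\<lambda>n j v. ennreal (2 * (real j + lam * measure lborel P * v - lam * measure lborel P)\<^sup>2
      + 2 * (real j * (lam * measure lborel P * v / (real (n - j) + 1) - 1))\<^sup>2))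
    \<le> ennreal ((2 + 20 / box_ratio TYPE('d) + 20 * real (CARD('d) + 1) / box_ratio TYPE('d))
      * min (real (card S)) (lam * measure lborel P))"
proof -
  obtain R :: "'d option \<Rightarrow> (real ^ 'd) set" and Z where
    R: "\<And>i. compact (R i)" "\<And>i. R i \<subseteq> P" "\<And>i. box_ratio TYPE('d) * measure lborel P \<le> measure lborel (R i)" and
    Z: "compact Z" "Z \<subseteq> P" "box_ratio TYPE('d) * measure lborel P \<le> measure lborel Z" and
    dom: "\<And>y z w. (\<And>i. y i \<in> R i) \<Longrightarrow> z \<in> Z \<Longrightarrow> \<exists>i. z \<bullet> w \<le> y i \<bullet> w"
    using hitting_regions[OF P_compact P_convex P_pos] by metis
  have prob_ge: "box_ratio TYPE('d) \<le> prob B"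
    if "compact B" "B \<subseteq> P" "box_ratio TYPE('d) * measure lborel P \<le> measure lborel B" for B
    using that P_pos by (simp add: measure_U borel_compact Int_absorb1 pos_le_divide_eq)
  have card: "CARD('d) + 1 = card (UNIV :: 'd option set)"
    by (simp add: card_option)
  have "1 \<le> real CARD('d)"
    by (simp add: Suc_le_eq)
  then have "1 \<le> 8 * real CARD('d)"
    by linarith
  then have k: "0 < box_ratio TYPE('d)" "box_ratio TYPE('d) \<le> 1"
    by (auto simp: box_ratio_def intro!: zero_less_power power_le_one)
  show ?thesis
    unfolding card
  proof (rule model_mean_risk_le[where R = R, OF large k])
    show "finite (UNIV :: 'd option set)" by simp
    show "R i \<in> sets U" for i
      using R(1) by (simp add: borel_compact)
    show "box_ratio TYPE('d) \<le> prob (R i)" for i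
      by (intro prob_ge R)
    show "emeasure U {z. z \<bullet> u = t} = 0" if "u \<in> S" for u t
      by (rule null_hyperplane[OF that])
    fix n and x :: "nat \<Rightarrow> real ^ 'd"
    assume "\<And>i. i \<in> UNIV \<Longrightarrow> \<exists>l<n. x l \<in> R i"
    then obtain l where l: "\<And>i. l i < n" "\<And>i. x (l i) \<in> R i"
      by (metis UNIV_I)
    \<comment> \<open>\<open>hitting_regions\<close> gives only weak domination, hence the weak
      hull; it has the same mass as the strict one.\<close>
    have "Z \<subseteq> weak_hull S (x ` {..<n})"
    proof
      fix z assume "z \<in> Z"
      have "\<exists>a\<in>x ` {..<n}. z \<bullet> u \<le> a \<bullet> u" for u
      proof -
        obtain i where "z \<bullet> u \<le> x (l i) \<bullet> u"
          using dom[of "\<lambda>i. x (l i)" z u] l(2) \<open>z \<in> Z\<close> by blast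
        then show ?thesis using l(1)[of i] by blast
      qed
      then show "z \<in> weak_hull S (x ` {..<n})" by (simp add: weak_hull_def)
    qed
    then have "prob Z \<le> prob (weak_hull S (x ` {..<n}))"
      by (intro finite_measure_mono) (simp_all add: weak_hull_borel)
    then show "box_ratio TYPE('d) \<le> hull_mass {..<n} x"
      using prob_ge[OF Z] by (simp add: prob_weak_hull hull_mass_def)
  qed
qed

lemma squared_error_le:
  assumes x: "\<And>i. x i \<in> P"
  defines "m \<equiv> lam * measure lborel P" and "j \<equiv> \<lambda>n. card (extremes S {..<n} x)" and "v \<equiv> \<lambda>n. hull_mass {..<n} x"
  shows "lam\<^sup>2 * (volume_estimator S E n x - measure lborel P)\<^sup>2
    \<le> 2 * (real (j n) + m * v n - m)\<^sup>2 + 2 * (real (j n) * (m * v n / (real (n - j n) + 1) - 1))\<^sup>2"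
proof (cases "n = 0")
  \<comment> \<open>Without sample points the estimator is the volume of the hull of the empty set,
    which lies between 0 and \<open>|P|\<close>, so the left-hand side is at most
    \<open>m^2\<close>. With \<open>j = v = 0\<close> the right-hand side is
    \<open>2 * m^2\<close>.\<close>
  case True
  have "wrapping_hull S E {} \<subseteq> P"
    by (rule wrapping_hull_subset[OF P_class]) simp
  then have "measure lborel (wrapping_hull S E {}) \<le> measure lborel P"
    using P_compact closed_wrapping_hull[of S E "{}"]
    by (intro measure_mono_fmeasurable) (auto simp: fmeasurable_compact borel_closed)
  then have "(measure lborel (wrapping_hull S E {}) - measure lborel P)\<^sup>2 \<le> (measure lborel P)\<^sup>2"
    by (subst power2_commute) (rule power_mono, simp_all)
  then have "lam\<^sup>2 * (measure lborel (wrapping_hull S E {}) - measure lborel P)\<^sup>2 \<le> m\<^sup>2"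
    unfolding m_def power_mult_distrib by (intro mult_left_mono) auto
  moreover have "v n = 0" "j n = 0"
    using True S_nonempty by (auto simp: v_def j_def hull_mass_def extremes_def strict_hull_empty)
  moreover have "volume_estimator S E n x = measure lborel (wrapping_hull S E {})"
    using True by (simp add: volume_estimator_def sample_hull_def num_interior_def)
  moreover have "m\<^sup>2 \<le> 2 * (real 0 + m * 0 - m)\<^sup>2 + 2 * (real 0 * (m * 0 / (real (n - 0) + 1) - 1))\<^sup>2"
    by simp
  ultimately show ?thesis
    by (simp only:)
next
  case False
  let ?A = "x ` {..<n}"
  have A: "finite ?A" "?A \<noteq> {}" "?A \<subseteq> P"
    using False x by auto
  have hull: "sample_hull S E n x = weak_hull S ?A"
    unfolding sample_hull_def by (rule wrapping_hull_eq[OF P_class A])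
  have "weak_hull S ?A \<subseteq> P"
    using wrapping_hull_subset[OF P_class A(3)] wrapping_hull_eq[OF P_class A] by simp
  then have "v n = measure lborel (weak_hull S ?A) / measure lborel P"
    unfolding v_def hull_mass_def prob_weak_hull[OF A(1), symmetric] measure_U[OF weak_hull_borel[OF A(1)]]
    by (simp only: Int_absorb1)
  then have vol: "measure lborel (sample_hull S E n x) = measure lborel P * v n"
    unfolding hull using P_pos by simp
  have "{i. i < n \<and> x i \<in> strict_hull S ?A} = {..<n} - extremes S {..<n} x"
    by (auto simp: extremes_def)
  then have int: "num_interior S E n x = n - j n"
    unfolding num_interior_def hull interior_weak_hull[OF S_finite S_zero] j_def
    by (simp add: card_Diff_subset extremes_subset finite_subset[OF extremes_subset])
  have jn: "j n \<le> n"
    unfolding j_def by (rule card_extremes_le)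
  have "lam * (volume_estimator S E n x - measure lborel P) = (real n + 1) / (real (n - j n) + 1) * (m * v n) - m"
  proof -
    have "lam * (a * (p * w) - p) = a * (lam * p * w) - lam * p" for a p w :: real
      by (simp add: algebra_simps)
    then show ?thesis
      by (simp only: volume_estimator_def int vol m_def)
  qed
  also have "(real n + 1) / (real (n - j n) + 1) = 1 + real (j n) / (real (n - j n) + 1)"
  proof -
    have "real n + 1 = (real (n - j n) + 1) + real (j n)"
      using jn by (simp add: of_nat_diff)
    then have "(real n + 1) / (real (n - j n) + 1)
        = (real (n - j n) + 1) / (real (n - j n) + 1) + real (j n) / (real (n - j n) + 1)"
      by (simp only: add_divide_distrib)
    also have "(real (n - j n) + 1) / (real (n - j n) + 1) = 1"
      by (rule divide_self) simp
    finally show ?thesis .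
  qed
  also have "(1 + real (j n) / (real (n - j n) + 1)) * (m * v n) - m
      = (real (j n) + m * v n - m) + real (j n) * (m * v n / (real (n - j n) + 1) - 1)"
  proof -
    have "(1 + r / D) * w - m = (r + w - m) + r * (w / D - 1)" for r D w :: real
      by (simp add: algebra_simps)
    then show ?thesis .
  qed
  finally have err: "lam * (volume_estimator S E n x - measure lborel P)
      = (real (j n) + m * v n - m) + real (j n) * (m * v n / (real (n - j n) + 1) - 1)" .
  have "(a + b)\<^sup>2 \<le> 2 * a\<^sup>2 + 2 * b\<^sup>2" for a b :: real
    using sum_squares_bound[of a b] by (simp add: power2_sum)
  then show ?thesis
    unfolding power_mult_distrib[symmetric] err by blast
qed

lemma mean_squared_error_le:
  "mean_squared_error lam S E P
    \<le> ennreal ((2 + 20 / box_ratio TYPE('d) + 20 * real (CARD('d) + 1) / box_ratio TYPE('d))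
      * min (real (card S)) (lam * measure lborel P) / lam\<^sup>2)"
proof -
  define m where "m = lam * measure lborel P"
  define F where "F n j v = ennreal (2 * (real j + m * v - m)\<^sup>2
      + 2 * (real j * (m * v / (real (n - j) + 1) - 1))\<^sup>2)" for n j :: nat and v
  define G where "G n x = ennreal (1 / lam\<^sup>2) * F n (card (extremes S {..<n} x)) (hull_mass {..<n} x)" for n x
  have m: "0 < m" using large by (simp add: m_def)
  have F_meas: "F n j \<in> borel_measurable borel" for n j
    unfolding F_def by measurable
  have G_meas: "G n \<in> borel_measurable (samples UNIV)" for n
    unfolding G_def by (intro borel_measurable_times_ennreal borel_measurable_const measurable_model F_meas)
  have inP: "AE x in samples UNIV. \<forall>i. x i \<in> P"
  proof -
    have "AE z in U. z \<in> P"
      using P_borel P_finite P_emeasure P_pos by (intro AE_uniform_measureI) auto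
    then have "AE x in samples UNIV. x i \<in> P" for i
      by (intro AE_PiM_component) (auto simp: prob_space_axioms)
    then show ?thesis by (intro AE_all_countable[THEN iffD2] allI)
  qed
  define T where "T = {x \<in> space (samples UNIV). \<forall>i. x i \<in> P}"
  have T: "T \<in> sets (samples UNIV)"
  proof -
    have [measurable]: "P \<in> sets U" using P_borel by simp
    show ?thesis unfolding T_def by measurable
  qed
  \<comment> \<open>A measurable function that dominates the squared error at every sample. Off
    \<open>T\<close> some point lies outside \<open>P\<close>, where \<open>squared_error_le\<close>
    gives nothing; the infinite value there is harmless, as \<open>T\<close> has full
    measure.\<close>
  define H where "H n x = (if x \<in> T then G n x else \<top>)" for n x
  have H_meas: "H n \<in> borel_measurable (samples UNIV)" for n
    unfolding H_def using T G_meas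
    by (intro measurable_If_set) (auto simp: Int_absorb2 sets.sets_into_space)
  have "mean_squared_error lam S E P \<le> (\<integral>\<^sup>+(n, x). H n x \<partial>poisson_model lam P)"
    unfolding mean_squared_error_def
  proof (intro nn_integral_mono, clarify)
    fix n x assume "(n, x) \<in> space (poisson_model lam P)"
    then have sp: "x \<in> space (samples UNIV)"
      by (auto simp: poisson_model_def space_pair_measure)
    show "ennreal ((volume_estimator S E n x - measure lborel P)\<^sup>2) \<le> H n x"
    proof (cases "x \<in> T")
      case True
      then have "\<And>i. x i \<in> P" by (simp add: T_def)
      from squared_error_le[OF this, of n]
      have "(volume_estimator S E n x - measure lborel P)\<^sup>2
        \<le> 1 / lam\<^sup>2 * (2 * (real (card (extremes S {..<n} x)) + m * hull_mass {..<n} x - m)\<^sup>2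
          + 2 * (real (card (extremes S {..<n} x)) * (m * hull_mass {..<n} x / (real (n - card (extremes S {..<n} x)) + 1) - 1))\<^sup>2)"
        unfolding m_def times_divide_eq_left mult_1
        using lam by (subst pos_le_divide_eq) (simp_all only: mult.commute[of _ "lam\<^sup>2"] zero_less_power)
      then have "ennreal ((volume_estimator S E n x - measure lborel P)\<^sup>2) \<le> G n x"
        unfolding G_def F_def by (subst ennreal_mult'[symmetric]) (auto intro: ennreal_leI)
      then show ?thesis using True by (simp add: H_def)
    next
      case False
      then show ?thesis by (simp add: H_def)
    qed
  qed
  also have "\<dots> = (\<integral>\<^sup>+n. \<integral>\<^sup>+x. H n x \<partial>samples UNIV \<partial>measure_pmf (poisson_pmf m))"
  proof -
    show ?thesis
      unfolding poisson_model_def m_def[symmetric]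
      using P.nn_integral_fst[OF measurable_count_pair[OF H_meas], of "poisson_pmf m"] by simp
  qed
  also have "\<dots> = (\<integral>\<^sup>+n. \<integral>\<^sup>+x. G n x \<partial>samples UNIV \<partial>measure_pmf (poisson_pmf m))"
  proof (rule nn_integral_cong, rule nn_integral_cong_AE)
    fix n
    show "AE x in samples UNIV. H n x = G n x"
      using inP AE_space by eventually_elim (simp add: H_def T_def)
  qed
  also have "\<dots> = model_mean m (\<lambda>n j v. ennreal (1 / lam\<^sup>2) * F n j v)"
    unfolding nn_integral_poisson_pmf[OF m] G_def model_mean_def ..
  also have "\<dots> = ennreal (1 / lam\<^sup>2) * model_mean m F"
    by (rule model_mean_cmult[OF F_meas])
  also have "\<dots> \<le> ennreal (1 / lam\<^sup>2) * ennreal ((2 + 20 / box_ratio TYPE('d) + 20 * real (CARD('d) + 1) / box_ratio TYPE('d))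
      * min (real (card S)) m)"
    unfolding F_def m_def by (intro mult_left_mono model_mean_risk) simp
  also have "\<dots> = ennreal ((2 + 20 / box_ratio TYPE('d) + 20 * real (CARD('d) + 1) / box_ratio TYPE('d))
      * min (real (card S)) m / lam\<^sup>2)"
    by (subst ennreal_mult'[symmetric]) auto
  finally show ?thesis
    unfolding m_def .
qed

text \<open>\<open>max 1 |E|\<close> serves both cases: it dominates the factor 1 of
  \<open>k\<close> and the factor \<open>|P|\<close> of \<lambda>, so the left-hand side is at most
  \<open>max 1 |E| * min k lam\<close>. Only here does the window enter the constant.\<close>

lemma min_count_le:
  "min (real (card S)) (lam * measure lborel P)
    \<le> 2 * max 1 (measure lborel E) * (real (card S) * lambert_W (lam / real (card S)))"
proof -
  let ?k = "real (card S)" and ?e = "max 1 (measure lborel E)"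
  have k: "0 < ?k" using S_finite S_nonempty by (simp add: card_gt_0_iff)
  have "min ?k (lam * measure lborel P) \<le> ?e * min ?k lam"
  proof (cases "?k \<le> lam")
    case True
    then have "?e * min ?k lam = ?e * ?k" by simp
    moreover have "1 * ?k \<le> ?e * ?k" using k by (intro mult_right_mono) auto
    ultimately show ?thesis by linarith
  next
    case False
    have "lam * measure lborel P \<le> lam * ?e"
      using P_le_E lam by (intro mult_left_mono) auto
    then show ?thesis using False by (simp add: min.coboundedI2 mult.commute)
  qed
  also have "min ?k lam = ?k * min 1 (lam / ?k)"
    using k by (simp add: min_mult_distrib_left)
  also have "?e * (?k * min 1 (lam / ?k)) \<le> ?e * (?k * (2 * lambert_W (lam / ?k)))"
    using k lam by (intro mult_left_mono lambert_W_ge) auto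
  finally show ?thesis by (simp add: mult_ac)
qed

end

theorem theorem5p6:
  shows "\<exists>C :: real \<Rightarrow> real.
    \<forall>(S :: (real ^ 'd) set) E (lam :: real) k. is_window S E \<and> k = card S \<and> lam > 0 \<longrightarrow>
      (SUP P \<in> {P \<in> polytope_class S E. lam * measure lborel P \<ge> 1}. mean_squared_error lam S E P)
        \<le> ennreal (C (measure lborel E) * (real k * lambert_W (lam / real k) / lam\<^sup>2)) \<and>
      (lam \<ge> exp 1 * real k \<longrightarrow>
        real k * lambert_W (lam / real k) / lam\<^sup>2 \<le> real k * ln (lam / real k) / lam\<^sup>2)"
proof -
  define c where "c = 2 + 20 / box_ratio TYPE('d) + 20 * real (CARD('d) + 1) / box_ratio TYPE('d)"
  have c: "0 \<le> c" by (auto simp: c_def box_ratio_def)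
  define C where "C e = c * (2 * max 1 e)" for e :: real
  have risk: "mean_squared_error lam S E P
      \<le> ennreal (C (measure lborel E) * (real (card S) * lambert_W (lam / real (card S)) / lam\<^sup>2))"
    if "is_window S E" "0 < lam" "P \<in> polytope_class S E" "1 \<le> lam * measure lborel P"
    for S E P :: "(real ^ 'd) set" and lam
  proof -
    interpret poisson_window S E P lam
      using that by unfold_locales
    have "c * min (real (card S)) (lam * measure lborel P) / lam\<^sup>2
        \<le> c * (2 * max 1 (measure lborel E) * (real (card S) * lambert_W (lam / real (card S)))) / lam\<^sup>2"
      using c by (intro divide_right_mono mult_left_mono min_count_le) auto
    then show ?thesis
      using order_trans[OF mean_squared_error_le[folded c_def] ennreal_leI] by (simp add: C_def mult.assoc)
  qed
  have log: "real k * lambert_W (lam / real k) / lam\<^sup>2 \<le> real k * ln (lam / real k) / lam\<^sup>2"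
    if "exp 1 * real k \<le> lam" for k :: nat and lam
  \<comment> \<open>For \<open>k = 0\<close> both sides vanish; otherwise the assumption says that
    \<open>lam / k\<close> is at least \<open>exp 1\<close>.\<close>
  proof (cases "k = 0")
    case False
    then show ?thesis
      using that by (intro divide_right_mono mult_left_mono lambert_W_le_ln) (auto simp: pos_le_divide_eq)
  qed simp
  show ?thesis
  proof (intro exI[of _ C] allI impI, elim conjE, intro conjI impI)
    fix S E :: "(real ^ 'd) set" and lam :: real and k
    assume w: "is_window S E" and k: "k = card S" and lam: "0 < lam"
    show "(SUP P \<in> {P \<in> polytope_class S E. 1 \<le> lam * measure lborel P}. mean_squared_error lam S E P)
        \<le> ennreal (C (measure lborel E) * (real k * lambert_W (lam / real k) / lam\<^sup>2))"
      unfolding k by (rule SUP_least) (use risk[OF w lam] in blast)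
  next
    fix lam :: real and k :: nat
    assume "exp 1 * real k \<le> lam"
    then show "real k * lambert_W (lam / real k) / lam\<^sup>2 \<le> real k * ln (lam / real k) / lam\<^sup>2"
      by (rule log)
  qed
qed

end
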